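(* Let $p$ be a prime and let $k$ be a field of characteristic $p$. Let $R=\mathbf W_{\mathbf Z_p^2}(k)/J$ with $J=\{\mathbf a: a_T=0\text{ for every cyclic }T\}$, and let $\Phi:R\to\mathrm{Lip}_{p^{-1}}(\mathbf P^1(\mathbf Q_p),\mathbf W(k))$ be the ring isomorphism sending $\mathbf a=(a_T)_{T\in\mathcal T}$ to the function whose value at the infinite rooted path $T_0,T_1,T_2,\dots$ is $(a_{T_0},a_{T_1},a_{T_2},\dots)$. Denote by $B\subset\mathrm{Lip}_{p^{-1}}(\mathbf P^1(\mathbf Q_p),\mathbf W(k))$ the image under $\Phi$ of the Teichmüller basis for $R$. Then the set $B$ consists of elements of the van der Put basis for $C(\mathbf P^1(\mathbf Q_p),\mathbf W(k))$ scaled to have Lipschitz constant $1/p$.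
   Context: Witt–Burnside rings. For a profinite group $G$, let $\mathcal F(G)$ be the set of isomorphism classes of finite discrete transitive $G$-sets (each is $G/H$, $H$ open). Write $U\le T$ if there is a $G$-map $T\to U$, and let $\varphi_T(U)$ be the number of $G$-maps $T\to U$. The $T$-th Witt polynomial is $W_T(\underline X)=\sum_{U\le T}\varphi_T(U)X_U^{\#T/\#U}$. By Dress–Siebeneicher there are unique polynomials $S_T,M_T\in\mathbf Z[\underline X,\underline Y]$ with $W_T(\underline X)+W_T(\underline Y)=W_T(\underline S)$ and $W_T(\underline X)W_T(\underline Y)=W_T(\underline M)$ for all $T$. For a commutative ring $A$, $\mathbf W_G(A)$ is the set $\prod_{T\in\mathcal F(G)}A$ with $\mathbf a+\mathbf b=(S_T(\mathbf a,\mathbf b))_T$ and $\mathbf a\mathbf b=(M_T(\mathbf a,\mathbf b))_T$; it is a commutative ring. $\mathbf W(k)=\mathbf W_{\mathbf Z_p}(k)$ is the ring of $p$-typical Witt vectors. Cyclic sets and the tree. A $\mathbf Z_p^2$-set $\mathbf Z_p^2/H$ is cyclic if the group $\mathbf Z_p^2/H$ is cyclic. The cyclic elements of $\mathcal F(\mathbf Z_p^2)$ are the vertices of a tree $\mathcal T$ rooted at $T_0=\mathbf Z_p^2/\mathbf Z_p^2$, with an edge between $U$ and $T$ when $U\le T$ and $\#T=p\,\#U$; this is the tree of $\mathbf Z_p$-lattices in $\mathbf Q_p^2$ up to $\mathbf Q_p^\times$-scaling. Elements of $R$ are identified with families $(a_T)_{T\in\mathcal T}$, $a_T\in k$. Teichmüller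 basis. For $a\in k$ and $T\in\mathcal T$, the Teichmüller element $\omega_T(a)$ has $T$-coordinate $a$ and all other coordinates $0$. The Teichmüller elements form a topological basis in the sense that every $\mathbf a=(a_T)_T$ equals $\sum_{n\ge 0}\sum_{\#T=p^n}\omega_T(a_T)$, with convergence in the topology in which the ideals $\{\mathbf a: a_T=0\text{ for }\#T<p^n\}$, $n\ge0$, are a fundamental system of neighborhoods of $0$. Boundary. $\mathbf P^1(\mathbf Q_p)$ is identified with the set of infinite non-backtracking paths $T_0,T_1,T_2,\dots$ in $\mathcal T$ starting at the root, with metric $d(x,y)=p^{-n}$ for $x\ne y$, where $n$ is the number of edges the paths $x,y$ have in common (and $d(x,x)=0$). Function spaces. For nonzero $w=(w_0,w_1,\dots)\in\mathbf W(k)$, $\|w\|_{\mathbf W(k)}=p^{-n}$ with $n$ the least index such that $w_n\ne0$; $\|0\|_{\mathbf W(k)}=0$. $C(\mathbf P^1(\mathbf Q_p),\mathbf W(k))$ is the ring of continuous functions; $\mathrm{Lip}_{\alpha}(\mathbf P^1(\mathbf Q_p),\mathbf W(k))$ is the ring of $f$ with $\|f(x)-f(y)\|_{\mathbf W(k)}\le\alpha\,d(x,y)$ for all $x,y$; the (least) Lipschitz constant of $f$ is the infimum of such $\alpha>0$. The van der Put basis of $C(\mathbf P^1(\mathbf Q_p),\mathbf W(k))$ is the set of all indicator functions of balls of positive radius in $\mathbf P^1(\mathbf Q_p)$. These indicator functions are continuous but their Lipschitz constants are unbounded; "scaled" means multiplied by a scalar, which may differ from one basis element to another, reducing the supremum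 norm until the Lipschitz constant is $p^{-1}$.
   Formalization: Elements ω_T(0) are excluded from the Teichmüller basis; for the root T_0, whose image is a constant function with Lipschitz constant 0, the condition "Lipschitz constant 1/p" is replaced by: the scalar multiplying the indicator of the whole space has norm 1. *)

theory Defs
  imports
    "HOL-Algebra.QuotRing"
    "HOL-Algebra.Elementary_Groups"
    "HOL-Algebra.Left_Coset"
    "HOL-Analysis.Product_Topology"
    "HOL-Analysis.Function_Topology"
    "HOL-Library.Poly_Mapping"
    "HOL-Computational_Algebra.Primes"
begin

section \<open>Finite transitive $G$-sets\<close>

text \<open>
  A profinite group is given by a group \<open>G\<close> together with a topology \<open>\<tau>\<close> on its carrier.  Every
  finite discrete transitive \<open>G\<close>-set is isomorphic to some \<open>G/H\<close> with \<open>H\<close> open, so an isomorphism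
  class is represented by the set of all open subgroups \<open>H\<close> for which \<open>G/H\<close> lies in the class.
  Open subgroups have finite index because \<open>G\<close> is compact.
\<close>

definition open_subgroups :: "('g, 'm) monoid_scheme \<Rightarrow> 'g topology \<Rightarrow> 'g set set" where
  "open_subgroups G \<tau> = {H. subgroup H G \<and> openin \<tau> H}"

definition gmaps :: "('g, 'm) monoid_scheme \<Rightarrow> 'g set \<Rightarrow> 'g set \<Rightarrow> ('g set \<Rightarrow> 'g set) set" where
  "gmaps G H K = {f \<in> (lcosets\<^bsub>G\<^esub> H) \<rightarrow>\<^sub>E (lcosets\<^bsub>G\<^esub> K).
     \<forall>g\<in>carrier G. \<forall>C\<in>lcosets\<^bsub>G\<^esub> H. f (g <#\<^bsub>G\<^esub> C) = g <#\<^bsub>G\<^esub> f C}"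

definition gset_class :: "('g, 'm) monoid_scheme \<Rightarrow> 'g topology \<Rightarrow> 'g set \<Rightarrow> 'g set set" where
  "gset_class G \<tau> H = {K \<in> open_subgroups G \<tau>.
     \<exists>f\<in>gmaps G H K. bij_betw f (lcosets\<^bsub>G\<^esub> H) (lcosets\<^bsub>G\<^esub> K)}"

definition gsets :: "('g, 'm) monoid_scheme \<Rightarrow> 'g topology \<Rightarrow> 'g set set set" where
  "gsets G \<tau> = gset_class G \<tau> ` open_subgroups G \<tau>"

definition stab :: "'g set set \<Rightarrow> 'g set" where
  "stab T = (SOME H. H \<in> T)"

definition gset_size :: "('g, 'm) monoid_scheme \<Rightarrow> 'g set set \<Rightarrow> nat" where
  "gset_size G T = card (lcosets\<^bsub>G\<^esub> (stab T))"

definition gset_le :: "('g, 'm) monoid_scheme \<Rightarrow> 'g set set \<Rightarrow> 'g set set \<Rightarrow> bool" where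
  "gset_le G U T \<longleftrightarrow> gmaps G (stab T) (stab U) \<noteq> {}"

definition num_gmaps :: "('g, 'm) monoid_scheme \<Rightarrow> 'g set set \<Rightarrow> 'g set set \<Rightarrow> nat" where
  "num_gmaps G T U = card (gmaps G (stab T) (stab U))"


section \<open>Witt--Burnside rings\<close>

definition witt_poly ::
  "('g, 'm) monoid_scheme \<Rightarrow> 'g topology \<Rightarrow> 'g set set \<Rightarrow> ('g set set \<Rightarrow> 'r) \<Rightarrow> 'r::comm_ring_1" where
  "witt_poly G \<tau> T x =
     (\<Sum>U\<in>{U \<in> gsets G \<tau>. gset_le G U T}.
        of_nat (num_gmaps G T U) * x U ^ (gset_size G T div gset_size G U))"

text \<open>
  Integer polynomials in two families of variables indexed by \<open>'i\<close>: the variable \<open>X\<^sub>i\<close> is \<open>Inl i\<close>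
  and \<open>Y\<^sub>i\<close> is \<open>Inr i\<close>.
\<close>

type_synonym 'i poly2 = "('i + 'i \<Rightarrow>\<^sub>0 nat) \<Rightarrow>\<^sub>0 int"

definition pvar :: "'i + 'i \<Rightarrow> 'i poly2" where
  "pvar v = Poly_Mapping.single (Poly_Mapping.single v 1) 1"

definition peval :: "('i + 'i \<Rightarrow> 'r) \<Rightarrow> 'i poly2 \<Rightarrow> 'r::comm_ring_1" where
  "peval \<rho> q = (\<Sum>m\<in>Poly_Mapping.keys q. of_int (Poly_Mapping.lookup q m) *
     (\<Prod>v\<in>Poly_Mapping.keys m. \<rho> v ^ Poly_Mapping.lookup m v))"

text \<open>
  The Dress--Siebeneicher polynomials \<open>S\<^sub>T\<close> and \<open>M\<^sub>T\<close>.  Since they are indexed by a type, the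
  family is required to be extensional, so that it is unique.
\<close>

definition witt_sum_polys ::
  "('g, 'm) monoid_scheme \<Rightarrow> 'g topology \<Rightarrow> 'g set set \<Rightarrow> 'g set set poly2" where
  "witt_sum_polys G \<tau> = (THE S. S \<in> extensional (gsets G \<tau>) \<and>
     (\<forall>T\<in>gsets G \<tau>. witt_poly G \<tau> T (\<lambda>U. pvar (Inl U)) + witt_poly G \<tau> T (\<lambda>U. pvar (Inr U))
        = witt_poly G \<tau> T S))"

definition witt_prod_polys ::
  "('g, 'm) monoid_scheme \<Rightarrow> 'g topology \<Rightarrow> 'g set set \<Rightarrow> 'g set set poly2" where
  "witt_prod_polys G \<tau> = (THE M. M \<in> extensional (gsets G \<tau>) \<and>
     (\<forall>T\<in>gsets G \<tau>. witt_poly G \<tau> T (\<lambda>U. pvar (Inl U)) * witt_poly G \<tau> T (\<lambda>U. pvar (Inr U))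
        = witt_poly G \<tau> T M))"

definition teichmueller ::
  "('g, 'm) monoid_scheme \<Rightarrow> 'g topology \<Rightarrow> 'g set set \<Rightarrow> 'a \<Rightarrow> ('g set set \<Rightarrow> 'a::comm_ring_1)" where
  "teichmueller G \<tau> T a = (\<lambda>U\<in>gsets G \<tau>. if U = T then a else 0)"

text \<open>The unit element is the Teichmueller element of \<open>1\<close> at the one-point set \<open>G/G\<close>.\<close>

definition witt_burnside ::
  "('g, 'm) monoid_scheme \<Rightarrow> 'g topology \<Rightarrow> ('g set set \<Rightarrow> 'a::comm_ring_1) ring" where
  "witt_burnside G \<tau> = \<lparr>
     carrier = gsets G \<tau> \<rightarrow>\<^sub>E UNIV,
     monoid.mult = (\<lambda>a b. \<lambda>T\<in>gsets G \<tau>. peval (case_sum a b) (witt_prod_polys G \<tau> T)),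
     one = teichmueller G \<tau> (gset_class G \<tau> (carrier G)) 1,
     zero = (\<lambda>T\<in>gsets G \<tau>. 0),
     add = (\<lambda>a b. \<lambda>T\<in>gsets G \<tau>. peval (case_sum a b) (witt_sum_polys G \<tau> T))\<rparr>"


section \<open>The groups $\mathbf{Z}_p$ and $\mathbf{Z}_p^2$, and $p$-typical Witt vectors\<close>

text \<open>
  The $p$-adic integers as the inverse limit of the groups $\mathbf{Z}/p^n$: an element is the
  sequence of its residues in \<open>{0..<p^n}\<close>.
\<close>

type_synonym padic = "nat \<Rightarrow> int"

definition Zp :: "nat \<Rightarrow> padic monoid" where
  "Zp p = \<lparr>
     carrier = {x. \<forall>n. x n \<in> {0..<int p ^ n} \<and> x (Suc n) mod int p ^ n = x n},
     monoid.mult = (\<lambda>x y n. (x n + y n) mod int p ^ n),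
     one = (\<lambda>n. 0)\<rparr>"

definition Zp_topology :: "nat \<Rightarrow> padic topology" where
  "Zp_topology p =
     subtopology (product_topology (\<lambda>_. discrete_topology UNIV) UNIV) (carrier (Zp p))"

definition Zp2 :: "nat \<Rightarrow> (padic \<times> padic) monoid" where
  "Zp2 p = Zp p \<times>\<times> Zp p"

definition Zp2_topology :: "nat \<Rightarrow> (padic \<times> padic) topology" where
  "Zp2_topology p = prod_topology (Zp_topology p) (Zp_topology p)"

type_synonym 'k witt = "padic set set \<Rightarrow> 'k"

definition Wp :: "nat \<Rightarrow> 'k::comm_ring_1 witt ring" where
  "Wp p = witt_burnside (Zp p) (Zp_topology p)"

text \<open>
  The subgroup below is the kernel of the projection onto $\mathbf{Z}/p^n$, that is
  $p^n\mathbf{Z}_p$; the \<open>n\<close>-th coordinate \<open>w\<^sub>n\<close> of a Witt vector is the one at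
  $\mathbf{Z}_p/p^n\mathbf{Z}_p$.
\<close>

definition witt_coord :: "nat \<Rightarrow> 'k witt \<Rightarrow> nat \<Rightarrow> 'k" where
  "witt_coord p w n = w (gset_class (Zp p) (Zp_topology p) {x \<in> carrier (Zp p). x n = 0})"

definition witt_norm :: "nat \<Rightarrow> 'k::comm_ring_1 witt \<Rightarrow> real" where
  "witt_norm p w =
     (if w = \<zero>\<^bsub>Wp p\<^esub> then 0 else (1 / real p) ^ (LEAST n. witt_coord p w n \<noteq> 0))"


section \<open>The tree and the ring $R$\<close>

type_synonym vertex = "(padic \<times> padic) set set"

definition tree :: "nat \<Rightarrow> vertex set" where
  "tree p = {T \<in> gsets (Zp2 p) (Zp2_topology p). cyclic_group (Zp2 p Mod stab T)}"

definition tree_root :: "nat \<Rightarrow> vertex" where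
  "tree_root p = gset_class (Zp2 p) (Zp2_topology p) (carrier (Zp2 p))"

definition tree_edge :: "nat \<Rightarrow> vertex \<Rightarrow> vertex \<Rightarrow> bool" where
  "tree_edge p U T \<longleftrightarrow> U \<in> tree p \<and> T \<in> tree p \<and>
     (gset_le (Zp2 p) U T \<and> gset_size (Zp2 p) T = p * gset_size (Zp2 p) U \<or>
      gset_le (Zp2 p) T U \<and> gset_size (Zp2 p) U = p * gset_size (Zp2 p) T)"

definition Wp2 :: "nat \<Rightarrow> (vertex \<Rightarrow> 'k::comm_ring_1) ring" where
  "Wp2 p = witt_burnside (Zp2 p) (Zp2_topology p)"

definition J_ideal :: "nat \<Rightarrow> (vertex \<Rightarrow> 'k::comm_ring_1) set" where
  "J_ideal p = {a \<in> carrier (Wp2 p). \<forall>T\<in>tree p. a T = 0}"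

definition R_ring :: "nat \<Rightarrow> (vertex \<Rightarrow> 'k::comm_ring_1) set ring" where
  "R_ring p = Wp2 p Quot J_ideal p"

definition R_class :: "nat \<Rightarrow> (vertex \<Rightarrow> 'k::comm_ring_1) \<Rightarrow> (vertex \<Rightarrow> 'k) set" where
  "R_class p a = J_ideal p +>\<^bsub>Wp2 p\<^esub> a"

text \<open>The zero element (\<open>a = 0\<close>) is not regarded as a member of the Teichmueller basis.\<close>

definition teichmueller_basis :: "nat \<Rightarrow> (vertex \<Rightarrow> 'k::comm_ring_1) set set" where
  "teichmueller_basis p =
     {R_class p (teichmueller (Zp2 p) (Zp2_topology p) T a) |T a. T \<in> tree p \<and> a \<noteq> 0}"


section \<open>The boundary $\mathbf{P}^1(\mathbf{Q}_p)$ and functions on it\<close>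

definition P1 :: "nat \<Rightarrow> (nat \<Rightarrow> vertex) set" where
  "P1 p = {x. x 0 = tree_root p \<and> (\<forall>n. tree_edge p (x n) (x (Suc n))) \<and>
              (\<forall>n. x (Suc (Suc n)) \<noteq> x n)}"

definition path_edges :: "(nat \<Rightarrow> vertex) \<Rightarrow> vertex set set" where
  "path_edges x = range (\<lambda>n. {x n, x (Suc n)})"

definition P1_dist :: "nat \<Rightarrow> (nat \<Rightarrow> vertex) \<Rightarrow> (nat \<Rightarrow> vertex) \<Rightarrow> real" where
  "P1_dist p x y =
     (if x = y then 0 else (1 / real p) ^ card (path_edges x \<inter> path_edges y))"

type_synonym 'k P1_fun = "(nat \<Rightarrow> vertex) \<Rightarrow> 'k witt"

definition lipschitz_with :: "nat \<Rightarrow> real \<Rightarrow> 'k::comm_ring_1 P1_fun \<Rightarrow> bool" where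
  "lipschitz_with p \<alpha> f \<longleftrightarrow>
     (\<forall>x\<in>P1 p. \<forall>y\<in>P1 p. witt_norm p (f x \<ominus>\<^bsub>Wp p\<^esub> f y) \<le> \<alpha> * P1_dist p x y)"

definition Lip_ring :: "nat \<Rightarrow> real \<Rightarrow> 'k::comm_ring_1 P1_fun ring" where
  "Lip_ring p \<alpha> = \<lparr>
     carrier = {f \<in> P1 p \<rightarrow>\<^sub>E carrier (Wp p). lipschitz_with p \<alpha> f},
     monoid.mult = (\<lambda>f g. \<lambda>x\<in>P1 p. f x \<otimes>\<^bsub>Wp p\<^esub> g x),
     one = (\<lambda>x\<in>P1 p. \<one>\<^bsub>Wp p\<^esub>),
     zero = (\<lambda>x\<in>P1 p. \<zero>\<^bsub>Wp p\<^esub>),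
     add = (\<lambda>f g. \<lambda>x\<in>P1 p. f x \<oplus>\<^bsub>Wp p\<^esub> g x)\<rparr>"

definition lip_const :: "nat \<Rightarrow> 'k::comm_ring_1 P1_fun \<Rightarrow> real" where
  "lip_const p f = Inf {\<alpha>. 0 < \<alpha> \<and> lipschitz_with p \<alpha> f}"

text \<open>
  Distances take only the values \<open>0\<close> and \<open>p\<^sup>-\<^sup>n\<close>, so closed and open balls of positive radius
  form the same family.
\<close>

definition P1_balls :: "nat \<Rightarrow> (nat \<Rightarrow> vertex) set set" where
  "P1_balls p = {{y \<in> P1 p. P1_dist p x y \<le> r} |x r. x \<in> P1 p \<and> 0 < r}"

definition P1_indicator :: "nat \<Rightarrow> (nat \<Rightarrow> vertex) set \<Rightarrow> 'k::comm_ring_1 P1_fun" where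
  "P1_indicator p D = (\<lambda>x\<in>P1 p. if x \<in> D then \<one>\<^bsub>Wp p\<^esub> else \<zero>\<^bsub>Wp p\<^esub>)"

definition van_der_put_basis :: "nat \<Rightarrow> 'k::comm_ring_1 P1_fun set" where
  "van_der_put_basis p = P1_indicator p ` P1_balls p"

text \<open>
  The scalar multiples of van der Put basis elements that have Lipschitz constant \<open>1/p\<close>.  The
  indicator of the whole space is constant, so all its multiples have Lipschitz constant \<open>0\<close>; its
  Lipschitz constant already is below \<open>1/p\<close> and needs no reduction of the supremum norm.  For this
  one basis element the scalar is therefore required to have norm \<open>1\<close>.
\<close>

definition scaled_van_der_put :: "nat \<Rightarrow> 'k::comm_ring_1 P1_fun set" where
  "scaled_van_der_put p = {f. \<exists>e\<in>van_der_put_basis p. \<exists>c\<in>carrier (Wp p).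
     f = (\<lambda>x\<in>P1 p. c \<otimes>\<^bsub>Wp p\<^esub> e x) \<and>
     (if e = P1_indicator p (P1 p) then witt_norm p c = 1 else lip_const p f = 1 / real p)}"

end

theory Submission
  imports Defs
begin

text \<open>
  The Teichmueller element of \<open>a \<noteq> 0\<close> at a vertex \<open>T\<close> with \<open>#T = p\<^sup>n\<close> has a single nonzero
  coordinate.  A rooted path visits exactly one vertex of each size \<open>p\<^sup>i\<close>, so \<open>T\<close> can occur on it at
  time \<open>n\<close> only.  Hence the image \<open>f\<close> of the Teichmueller element is the function that is \<open>0\<close> on paths
  avoiding \<open>T\<close> and the Witt vector \<open>c = (0, \<dots>, 0, a, 0, \<dots>)\<close>, with \<open>a\<close> in place \<open>n\<close>, on the paths
  through \<open>T\<close>; in other words \<open>f\<close> is \<open>c\<close> times the indicator of the set \<open>D\<close> of paths through \<open>T\<close>.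

  \<open>D\<close> is a ball: in a tree two paths that meet at time \<open>n\<close> agree up to time \<open>n\<close>, so \<open>D\<close> is the
  ball of radius \<open>p\<^sup>-\<^sup>n\<close> around any of its points.  If \<open>n = 0\<close> then \<open>D\<close> is the whole boundary and \<open>c\<close> has
  norm \<open>1\<close>.  If \<open>n > 0\<close>, the Lipschitz constant of \<open>f\<close> is at most \<open>1/p\<close> because \<open>f\<close> lies in the target
  of \<open>\<Phi>\<close>, and it is at least \<open>1/p\<close> because a path through \<open>T\<close> and a path that leaves it just before \<open>T\<close>
  have distance \<open>p\<^sup>1\<^sup>-\<^sup>n\<close>, while the values \<open>c\<close> and \<open>0\<close> of \<open>f\<close> differ by \<open>c\<close>, of norm \<open>p\<^sup>-\<^sup>n\<close>.

  Two bodies of facts make this precise.  The first is the shape of the tree.  An open subgroup of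
  \<open>\<int>\<^sub>p\<^sup>2\<close> with cyclic quotient is the kernel of a linear form \<open>(x, y) \<mapsto> u x + v y\<close> modulo \<open>p\<^sup>n\<close>, where \<open>u\<close>
  and \<open>v\<close> are integers that are not both divisible by \<open>p\<close> (\<open>tree_eq\<close>); from this one reads off that
  every vertex but the root has exactly one parent (\<open>parent_exists\<close>, \<open>parent_unique\<close>) and that every
  vertex has at least two children (\<open>two_children\<close>).

  The second is a minimum of arithmetic in \<open>\<^bold>W(k)\<close>, namely \<open>c \<cdot> 1 = c\<close>, \<open>c \<cdot> 0 = 0\<close> and \<open>c - 0 = c\<close>.  The
  operations are given by the integral polynomials that are determined by their ghost components, so
  these polynomials must first be shown to exist.  This is Dwork's lemma (\<open>dwork\<close>): over a ring of
  integral polynomials, a sequence is a sequence of ghost components as soon as its terms satisfy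
  the congruences \<open>a\<^sub>n\<^sub>+\<^sub>1 \<equiv> \<phi>(a\<^sub>n)\<close> modulo \<open>p\<^sup>n\<^sup>+\<^sup>1\<close>, where \<open>\<phi>\<close> raises every variable to its \<open>p\<close>-th power.
  The three identities then follow by specialising the second family of variables to the coordinates
  of \<open>0\<close> or \<open>1\<close> and comparing ghost components.
\<close>

section \<open>Transitive sets of a commutative group\<close>

context comm_group
begin

lemma l_coset_eq_iff:
  assumes "subgroup H G" "x \<in> carrier G" "y \<in> carrier G"
  shows "x <# H = y <# H \<longleftrightarrow> inv x \<otimes> y \<in> H"
  using assms l_repr_independence lcos_self subgroup.lcos_module_imp subgroup.lcos_module_rev is_group
  by metis

lemma subgroup_in_lcosets: "subgroup H G \<Longrightarrow> H \<in> lcosets H"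
  unfolding LCOSETS_def using lcos_mult_one[OF subgroup.subset] by force

lemma lcosetsE:
  assumes "C \<in> lcosets H"
  obtains x where "x \<in> carrier G" "C = x <# H"
  using assms by (auto simp: LCOSETS_def)

lemma lcosetsI: "x \<in> carrier G \<Longrightarrow> x <# H \<in> lcosets H"
  by (auto simp: LCOSETS_def)

lemma gmaps_coset:
  assumes "subgroup H G" "f \<in> gmaps G H K" "x \<in> carrier G"
  shows "f (x <# H) = x <# f H"
  using assms subgroup_in_lcosets unfolding gmaps_def by blast

text \<open>
  A \<open>G\<close>-map sends the coset \<open>H\<close>, which is fixed by \<open>H\<close>, to a coset fixed by \<open>H\<close>; in a commutative group
  every coset of \<open>K\<close> has stabiliser \<open>K\<close>.
\<close>

lemma gmaps_imp_subset:
  assumes H: "subgroup H G" and K: "subgroup K G" and f: "f \<in> gmaps G H K"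
  shows "H \<subseteq> K"
proof
  fix h assume h: "h \<in> H"
  then have hc: "h \<in> carrier G" using H by (simp add: subgroup.mem_carrier)
  have "f H \<in> lcosets K"
    using f subgroup_in_lcosets[OF H] unfolding gmaps_def by auto
  then obtain g where g: "g \<in> carrier G" "f H = g <# K" by (rule lcosetsE)
  have "h <# H = H" using H h by (simp add: coset_join3 hc)
  then have "h <# (g <# K) = g <# K"
    using gmaps_coset[OF H f hc] g by simp
  then have "(g \<otimes> h) <# K = g <# K"
    using g hc by (simp add: lcos_m_assoc subgroup.subset[OF K] m_comm)
  then have "inv g \<otimes> (g \<otimes> h) \<in> K"
    using l_coset_eq_iff[OF K g(1), of "g \<otimes> h"] g hc by simp
  then show "h \<in> K" using g hc by (simp add: m_assoc[symmetric])
qed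

lemma set_mult_l_cosets:
  assumes H: "subgroup H G" and K: "subgroup K G" and "H \<subseteq> K"
    and x: "x \<in> carrier G" and g: "g \<in> carrier G"
  shows "(x <# H) <#> (g <# K) = (x \<otimes> g) <# K"
proof (intro equalityI subsetI)
  fix z assume "z \<in> (x <# H) <#> (g <# K)"
  then obtain h k where hk: "h \<in> H" "k \<in> K" "z = (x \<otimes> h) \<otimes> (g \<otimes> k)"
    by (auto simp: set_mult_def l_coset_def)
  then have c: "h \<in> carrier G" "k \<in> carrier G"
    using H K by (auto simp: subgroup.mem_carrier)
  have "z = (x \<otimes> g) \<otimes> (h \<otimes> k)" using hk(3) c x g by (simp add: m_ac)
  moreover have "h \<otimes> k \<in> K" using hk \<open>H \<subseteq> K\<close> K by (auto simp: subgroup.m_closed)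
  ultimately show "z \<in> (x \<otimes> g) <# K" by (auto simp: l_coset_def)
next
  fix z assume "z \<in> (x \<otimes> g) <# K"
  then obtain k where k: "k \<in> K" "z = (x \<otimes> g) \<otimes> k" by (auto simp: l_coset_def)
  then have "z = (x \<otimes> \<one>) \<otimes> (g \<otimes> k)"
    using x g K by (simp add: subgroup.mem_carrier m_assoc)
  then show "z \<in> (x <# H) <#> (g <# K)"
    using k subgroup.one_closed[OF H] unfolding set_mult_def l_coset_def by blast
qed

text \<open>
  For \<open>H \<subseteq> K\<close> and a coset \<open>gK\<close>, the setwise product \<open>C \<mapsto> C \<cdot> gK\<close> is the \<open>G\<close>-map that sends \<open>H\<close> to \<open>gK\<close>.
  Using the product of sets avoids choosing representatives.
\<close>

lemma translation_in_gmaps: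
  assumes H: "subgroup H G" and K: "subgroup K G" and HK: "H \<subseteq> K" and g: "g \<in> carrier G"
  shows "(\<lambda>C\<in>lcosets H. C <#> (g <# K)) \<in> gmaps G H K"
proof -
  have "C <#> (g <# K) \<in> lcosets K" if "C \<in> lcosets H" for C
    using that by (elim lcosetsE) (simp add: set_mult_l_cosets[OF H K HK] g lcosetsI)
  moreover have "x <# C \<in> lcosets H \<and> (x <# C) <#> (g <# K) = x <# (C <#> (g <# K))"
    if "x \<in> carrier G" "C \<in> lcosets H" for x C
    using that(2) by (elim lcosetsE)
      (simp add: that(1) set_mult_l_cosets[OF H K HK] g lcosetsI lcos_m_assoc
        subgroup.subset[OF H] subgroup.subset[OF K] m_assoc)
  ultimately show ?thesis unfolding gmaps_def by simp
qed

lemma gmaps_nonempty_iff: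
  assumes "subgroup H G" "subgroup K G"
  shows "gmaps G H K \<noteq> {} \<longleftrightarrow> H \<subseteq> K"
  using gmaps_imp_subset[OF assms] translation_in_gmaps[OF assms _ one_closed] by blast

text \<open>
  As \<open>G/H\<close> is generated by the coset \<open>H\<close>, a \<open>G\<close>-map is determined by its value there.
\<close>

lemma bij_betw_gmaps:
  assumes H: "subgroup H G" and K: "subgroup K G" and HK: "H \<subseteq> K"
  shows "bij_betw (\<lambda>f. f H) (gmaps G H K) (lcosets K)"
proof (rule bij_betw_imageI)
  show "inj_on (\<lambda>f. f H) (gmaps G H K)"
  proof (rule inj_onI)
    fix f f' assume f: "f \<in> gmaps G H K" "f' \<in> gmaps G H K" and eq: "f H = f' H"
    show "f = f'"
    proof (rule extensionalityI[of f "lcosets H"])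
      show "f \<in> extensional (lcosets H)" "f' \<in> extensional (lcosets H)"
        using f unfolding gmaps_def by (auto simp: PiE_def)
      show "f C = f' C" if "C \<in> lcosets H" for C
        using that by (elim lcosetsE) (simp add: gmaps_coset[OF H f(1)] gmaps_coset[OF H f(2)] eq)
    qed
  qed
  show "(\<lambda>f. f H) ` gmaps G H K = lcosets K"
  proof (intro equalityI subsetI)
    fix C assume "C \<in> (\<lambda>f. f H) ` gmaps G H K"
    then show "C \<in> lcosets K"
      using subgroup_in_lcosets[OF H] unfolding gmaps_def by auto
  next
    fix C assume "C \<in> lcosets K"
    then obtain g where g: "g \<in> carrier G" "C = g <# K" by (rule lcosetsE)
    let ?f = "\<lambda>C\<in>lcosets H. C <#> (g <# K)"
    have "?f H = (\<one> <# H) <#> (g <# K)"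
      using subgroup_in_lcosets[OF H] by (simp add: lcos_mult_one subgroup.subset[OF H])
    also have "\<dots> = C" using set_mult_l_cosets[OF H K HK one_closed g(1)] g by simp
    finally have "?f H = C" .
    then show "C \<in> (\<lambda>f. f H) ` gmaps G H K"
      by (rule image_eqI[OF sym translation_in_gmaps[OF H K HK g(1)]])
  qed
qed

text \<open>
  Stabilisers in isomorphic transitive sets are conjugate, hence equal in a commutative group: the
  isomorphism class of \<open>G/H\<close> is represented by \<open>H\<close> alone.
\<close>

lemma gset_class_eq:
  assumes H: "H \<in> open_subgroups G \<tau>"
  shows "gset_class G \<tau> H = {H}"
proof -
  have sH: "subgroup H G" using H by (simp add: open_subgroups_def)
  have "K = H" if K: "subgroup K G" and f: "f \<in> gmaps G H K"
    and bij: "bij_betw f (lcosets H) (lcosets K)" for K f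
  proof
    show "H \<subseteq> K" using gmaps_imp_subset[OF sH K f] .
    show "K \<subseteq> H"
    proof
      fix k assume k: "k \<in> K"
      then have kc: "k \<in> carrier G" using K by (simp add: subgroup.mem_carrier)
      have "f H \<in> lcosets K" using f subgroup_in_lcosets[OF sH] unfolding gmaps_def by auto
      then obtain g where g: "g \<in> carrier G" "f H = g <# K" by (rule lcosetsE)
      have "f (k <# H) = (g \<otimes> k) <# K"
        using gmaps_coset[OF sH f kc] g kc by (simp add: lcos_m_assoc subgroup.subset[OF K] m_comm)
      also have "\<dots> = g <# K"
        using g kc k l_coset_eq_iff[OF K g(1), of "g \<otimes> k"] by (simp add: m_assoc[symmetric])
      finally have "f (k <# H) = f H" using g by simp
      then have "k <# H = H"
        using bij lcosetsI[OF kc] subgroup_in_lcosets[OF sH] by (meson bij_betw_imp_inj_on inj_onD)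
      then show "k \<in> H" using lcos_self[OF kc sH] by simp
    qed
  qed
  moreover have "bij_betw (\<lambda>C\<in>lcosets H. C <#> (\<one> <# H)) (lcosets H) (lcosets H)"
  proof -
    have "(\<lambda>C\<in>lcosets H. C <#> (\<one> <# H)) C = C" if "C \<in> lcosets H" for C
      using that by (elim lcosetsE) (simp add: lcosetsI set_mult_l_cosets[OF sH sH])
    then show ?thesis by (intro bij_betw_byWitness[where f' = "\<lambda>C. C"]) auto
  qed
  ultimately show ?thesis
    using H translation_in_gmaps[OF sH sH order_refl one_closed]
    unfolding gset_class_def open_subgroups_def by blast
qed

lemma gsets_eq: "gsets G \<tau> = (\<lambda>H. {H}) ` open_subgroups G \<tau>"
  unfolding gsets_def by (rule image_cong) (simp_all add: gset_class_eq)

text \<open>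
  Indices below are computed by exhibiting a function \<open>\<chi>\<close> whose fibres are the cosets.
\<close>

lemma card_lcosets_eq_card_image:
  assumes H: "subgroup H G"
    and \<chi>: "\<And>x y. x \<in> carrier G \<Longrightarrow> y \<in> carrier G \<Longrightarrow> inv x \<otimes> y \<in> H \<longleftrightarrow> \<chi> x = \<chi> y"
  shows "card (lcosets H) = card (\<chi> ` carrier G)"
proof -
  let ?r = "\<lambda>x. x <# H"
  have eq: "?r x = ?r y \<longleftrightarrow> \<chi> x = \<chi> y" if "x \<in> carrier G" "y \<in> carrier G" for x y
    using that \<chi> l_coset_eq_iff[OF H] by blast
  have lc: "lcosets H = ?r ` carrier G" by (auto simp: LCOSETS_def)
  let ?s = "\<lambda>C. \<chi> (inv_into (carrier G) ?r C)"
  have val: "?s (?r x) = \<chi> x" if "x \<in> carrier G" for x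
    using that eq[OF inv_into_into[of "?r x" ?r "carrier G"]] f_inv_into_f[of "?r x" ?r "carrier G"] by blast
  have "inj_on ?s (lcosets H)"
    unfolding lc by (rule inj_onI) (elim imageE, simp only: val eq)
  moreover have "?s ` (lcosets H) = \<chi> ` carrier G"
    unfolding lc image_image by (rule image_cong) (simp_all add: val)
  ultimately show ?thesis by (metis card_image)
qed

lemma cyclic_Mod_iff:
  assumes H: "subgroup H G"
  shows "cyclic_group (G Mod H) \<longleftrightarrow>
    (\<exists>g\<in>carrier G. \<forall>z\<in>carrier G. \<exists>k::int. inv z \<otimes> (g [^] k) \<in> H)"
proof -
  have N: "H \<lhd> G" using H by (rule subgroup_imp_normal)
  have eq: "H #> z = H #> w \<longleftrightarrow> inv z \<otimes> w \<in> H" if "z \<in> carrier G" "w \<in> carrier G" for z w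
    using l_coset_eq_iff[OF H that] normal.coset_eq[OF N] that by simp
  have carr: "carrier (G Mod H) = (\<lambda>z. H #> z) ` carrier G"
    by (auto simp: FactGroup_def RCOSETS_def)
  have "cyclic_group (G Mod H) \<longleftrightarrow>
     (\<exists>g\<in>carrier G. (\<lambda>z. H #> z) ` carrier G = range (\<lambda>n::int. H #> (g [^] n)))"
    unfolding group.cyclic_group[OF normal.factorgroup_is_group[OF N]] carr
    by (simp add: normal.FactGroup_int_pow[OF N])
  also have "\<dots> \<longleftrightarrow> (\<exists>g\<in>carrier G. \<forall>z\<in>carrier G. \<exists>k::int. inv z \<otimes> (g [^] k) \<in> H)"
  proof (intro bex_cong refl)
    fix g assume g: "g \<in> carrier G"
    then have "range (\<lambda>n::int. H #> (g [^] n)) \<subseteq> (\<lambda>z. H #> z) ` carrier G" by auto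
    then have "(\<lambda>z. H #> z) ` carrier G = range (\<lambda>n::int. H #> (g [^] n)) \<longleftrightarrow>
        (\<lambda>z. H #> z) ` carrier G \<subseteq> range (\<lambda>n::int. H #> (g [^] n))"
      by blast
    also have "\<dots> \<longleftrightarrow> (\<forall>z\<in>carrier G. \<exists>k::int. inv z \<otimes> (g [^] k) \<in> H)"
      using g by (simp add: image_subset_iff image_iff eq)
    finally show "(\<lambda>z. H #> z) ` carrier G = range (\<lambda>n::int. H #> (g [^] n)) \<longleftrightarrow>
        (\<forall>z\<in>carrier G. \<exists>k::int. inv z \<otimes> (g [^] k) \<in> H)" .
  qed
  finally show ?thesis .
qed

lemma mem_subgroup_cong:
  assumes H: "subgroup H G" and xy: "x \<in> carrier G" "y \<in> carrier G" and d: "inv x \<otimes> y \<in> H"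
  shows "x \<in> H \<longleftrightarrow> y \<in> H"
proof
  assume "x \<in> H"
  then have "x \<otimes> (inv x \<otimes> y) \<in> H" using d by (rule subgroup.m_closed[OF H])
  then show "y \<in> H" using xy by (simp add: m_assoc[symmetric])
next
  assume "y \<in> H"
  then have "y \<otimes> inv (inv x \<otimes> y) \<in> H"
    by (rule subgroup.m_closed[OF H _ subgroup.m_inv_closed[OF H d]])
  then show "x \<in> H" using xy by (simp add: inv_mult m_lcomm)
qed

text \<open>
  This replaces \<open>a\<close> by \<open>g\<close> and \<open>b\<close> by \<open>h\<close> inside a product, at the cost of factors that will lie in a given
  subgroup.
\<close>

lemma cancel_two:
  assumes "z \<in> carrier G" "a \<in> carrier G" "b \<in> carrier G" "g \<in> carrier G" "h \<in> carrier G"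
  shows "(z \<otimes> (a \<otimes> b)) \<otimes> ((inv a \<otimes> g) \<otimes> (inv b \<otimes> h)) = z \<otimes> (g \<otimes> h)"
proof -
  have "(z \<otimes> (a \<otimes> b)) \<otimes> ((inv a \<otimes> g) \<otimes> (inv b \<otimes> h)) =
      ((a \<otimes> inv a) \<otimes> (b \<otimes> inv b)) \<otimes> (z \<otimes> (g \<otimes> h))"
    using assms by (simp only: m_ac m_closed inv_closed)
  then show ?thesis using assms by simp
qed

end

lemma stab_singleton [simp]: "stab {H} = H"
  by (simp add: stab_def)

text \<open>
  The integers \<open>k\<close> with \<open>g\<^sup>k \<in> H\<close> form an ideal of \<open>\<int>\<close>; it contains \<open>p\<^sup>N\<close>, so it is generated by some \<open>p\<^sup>n\<close>.
\<close>

lemma (in group) exponents_into_subgroup: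
  assumes "prime p" and H: "subgroup H G" and g: "g \<in> carrier G" and N: "g [^] (int p ^ N) \<in> H"
  obtains n where "n \<le> N" "\<And>k::int. g [^] k \<in> H \<longleftrightarrow> int p ^ n dvd k"
proof -
  have dvd: "g [^] (a * b) \<in> H" if "g [^] a \<in> H" for a b :: int
    using subgroup_int_pow_closed[OF H that, of b] by (simp add: int_pow_pow g)
  define n where "n = (LEAST n. g [^] (int p ^ n) \<in> H)"
  have n: "g [^] (int p ^ n) \<in> H" "n \<le> N"
    unfolding n_def by (rule LeastI[of _ N], rule N) (rule Least_le, rule N)
  have "int p ^ n dvd k" if k: "g [^] k \<in> H" for k
  proof -
    obtain u v where uv: "u * k + v * int p ^ N = gcd k (int p ^ N)" using bezout_int by blast
    have "g [^] (gcd k (int p ^ N)) = g [^] (k * u) \<otimes> g [^] (int p ^ N * v)"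
      by (simp add: uv[symmetric] int_pow_mult g mult.commute)
    then have *: "g [^] (gcd k (int p ^ N)) \<in> H"
      using dvd[OF k] dvd[OF N] H by (simp add: subgroup.m_closed)
    have "prime (int p)" using \<open>prime p\<close> by simp
    then obtain m where m: "normalize (gcd k (int p ^ N)) = int p ^ m"
      using divides_primepow[of "int p" "gcd k (int p ^ N)" N] by auto
    then have gcd: "gcd k (int p ^ N) = int p ^ m" by simp
    then have "n \<le> m" unfolding n_def using * by (intro Least_le) simp
    then have "int p ^ n dvd int p ^ m" by (simp add: le_imp_power_dvd)
    then show ?thesis using gcd by (metis dvd_trans gcd_dvd1)
  qed
  moreover have "g [^] k \<in> H" if "int p ^ n dvd k" for k
    using that dvd[OF n(1)] by (auto elim: dvdE)
  ultimately show thesis using that n(2) by blast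
qed


section \<open>The groups $\mathbf{Z}_p$ and $\mathbf{Z}_p^2$\<close>

lemma int_power_dvd_iff:
  assumes "1 < p"
  shows "int p ^ i dvd int p ^ n \<longleftrightarrow> i \<le> n"
proof
  assume "int p ^ i dvd int p ^ n"
  then have "p ^ i dvd p ^ n" by (simp flip: of_nat_power)
  then show "i \<le> n" using assms by (rule power_dvd_imp_le)
qed (rule le_imp_power_dvd)

lemma carrier_Zp: "carrier (Zp p) = {x. \<forall>n. x n \<in> {0..<int p ^ n} \<and> x (Suc n) mod int p ^ n = x n}"
  by (simp add: Zp_def)

lemma mult_Zp [simp]: "x \<otimes>\<^bsub>Zp p\<^esub> y = (\<lambda>n. (x n + y n) mod int p ^ n)"
  by (simp add: Zp_def)

lemma one_Zp [simp]: "\<one>\<^bsub>Zp p\<^esub> = (\<lambda>n. 0)"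
  by (simp add: Zp_def)

lemma Zp_mod:
  assumes "x \<in> carrier (Zp p)" "m \<le> n"
  shows "x n mod int p ^ m = x m"
  using assms(2)
proof (induction rule: dec_induct)
  case base
  then show ?case using assms(1) by (simp add: carrier_Zp)
next
  case (step n)
  have "x (Suc n) mod int p ^ m = x (Suc n) mod int p ^ n mod int p ^ m"
    using step(1) by (simp add: mod_mod_cancel le_imp_power_dvd)
  then show ?case using assms(1) step by (simp add: carrier_Zp)
qed

lemma Zp_reduce_mem:
  assumes "0 < p" and "\<And>n. int p ^ n dvd y (Suc n) - y n"
  shows "(\<lambda>n. y n mod int p ^ n) \<in> carrier (Zp p)"
proof -
  have "y (Suc n) mod int p ^ Suc n mod int p ^ n = y n mod int p ^ n" for n
  proof -
    have "y (Suc n) mod int p ^ Suc n mod int p ^ n = y (Suc n) mod int p ^ n"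
      by (rule mod_mod_cancel) simp
    also have "\<dots> = y n mod int p ^ n" using assms(2)[of n] by (simp only: mod_eq_dvd_iff)
    finally show ?thesis .
  qed
  then show ?thesis using \<open>0 < p\<close> by (simp add: carrier_Zp)
qed

lemma Zp_step_dvd: "x \<in> carrier (Zp p) \<Longrightarrow> int p ^ n dvd x (Suc n) - x n"
  by (simp add: carrier_Zp mod_eq_dvd_iff[symmetric])

lemma Zp_comm_group:
  assumes "0 < p"
  shows "comm_group (Zp p)"
proof (rule comm_groupI)
  fix x y assume x: "x \<in> carrier (Zp p)" and y: "y \<in> carrier (Zp p)"
  have "int p ^ n dvd (x (Suc n) - x n) + (y (Suc n) - y n)" for n
    by (intro dvd_add Zp_step_dvd x y)
  then show "x \<otimes>\<^bsub>Zp p\<^esub> y \<in> carrier (Zp p)"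
    unfolding mult_Zp by (intro Zp_reduce_mem assms) (simp add: algebra_simps)
next
  fix x y z assume "x \<in> carrier (Zp p)" "y \<in> carrier (Zp p)" "z \<in> carrier (Zp p)"
  then show "x \<otimes>\<^bsub>Zp p\<^esub> y \<otimes>\<^bsub>Zp p\<^esub> z = x \<otimes>\<^bsub>Zp p\<^esub> (y \<otimes>\<^bsub>Zp p\<^esub> z)"
    by (simp add: mod_simps add.assoc)
next
  fix x assume x: "x \<in> carrier (Zp p)"
  have "int p ^ n dvd - (x (Suc n) - x n)" for n
    using Zp_step_dvd[OF x] by (simp only: dvd_minus_iff)
  then have "(\<lambda>n. (- x n) mod int p ^ n) \<in> carrier (Zp p)"
    by (intro Zp_reduce_mem assms) (simp add: algebra_simps)
  then show "\<exists>y\<in>carrier (Zp p). y \<otimes>\<^bsub>Zp p\<^esub> x = \<one>\<^bsub>Zp p\<^esub>"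
    by (rule bexI[rotated]) (simp add: mod_simps)
qed (use assms in \<open>auto simp: carrier_Zp add.commute\<close>)

lemma inv_Zp:
  assumes "0 < p" "x \<in> carrier (Zp p)"
  shows "inv\<^bsub>Zp p\<^esub> x = (\<lambda>n. (- x n) mod int p ^ n)"
proof -
  interpret comm_group "Zp p" using Zp_comm_group[OF assms(1)] .
  have "int p ^ n dvd - (x (Suc n) - x n)" for n
    using Zp_step_dvd[OF assms(2)] by (simp only: dvd_minus_iff)
  then have "(\<lambda>n. (- x n) mod int p ^ n) \<in> carrier (Zp p)"
    by (intro Zp_reduce_mem assms) (simp add: algebra_simps)
  then show ?thesis
    by (intro inv_equality) (simp_all add: assms mod_simps)
qed

lemma pow_Zp:
  assumes "0 < p" "x \<in> carrier (Zp p)"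
  shows "x [^]\<^bsub>Zp p\<^esub> (k::int) = (\<lambda>n. (k * x n) mod int p ^ n)"
proof -
  interpret comm_group "Zp p" using Zp_comm_group[OF assms(1)] .
  have nat: "x [^]\<^bsub>Zp p\<^esub> m = (\<lambda>n. (int m * x n) mod int p ^ n)" for m :: nat
    by (induction m) (simp_all add: mod_simps algebra_simps)
  show ?thesis
  proof (cases k rule: int_cases)
    case (nonneg m)
    then show ?thesis by (simp add: int_pow_int nat)
  next
    case (neg m)
    have "x [^]\<^bsub>Zp p\<^esub> Suc m \<in> carrier (Zp p)" using assms(2) by (rule nat_pow_closed)
    then have "inv\<^bsub>Zp p\<^esub> (x [^]\<^bsub>Zp p\<^esub> Suc m) = (\<lambda>n. (- (int (Suc m) * x n mod int p ^ n)) mod int p ^ n)"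
      by (simp only: inv_Zp[OF assms(1)] nat)
    then show ?thesis
      unfolding neg int_pow_neg_int[OF assms(2)] by (simp only: mod_minus_eq mult_minus_left)
  qed
qed

definition Zp_of_int :: "nat \<Rightarrow> int \<Rightarrow> padic" where
  "Zp_of_int p k = (\<lambda>n. k mod int p ^ n)"

lemma Zp_of_int_mem: "0 < p \<Longrightarrow> Zp_of_int p k \<in> carrier (Zp p)"
  unfolding Zp_of_int_def by (rule Zp_reduce_mem) simp_all

text \<open>
  The subgroup \<open>p\<^sup>n\<int>\<^sub>p\<close>.
\<close>

definition pn_Zp :: "nat \<Rightarrow> nat \<Rightarrow> padic set" where
  "pn_Zp p n = {x \<in> carrier (Zp p). x n = 0}"

lemma Zp2_comm_group:
  assumes "0 < p"
  shows "comm_group (Zp2 p)"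
proof -
  interpret comm_group "Zp p" using Zp_comm_group[OF assms] .
  interpret D: group "Zp2 p" unfolding Zp2_def by (intro DirProd_group is_group)
  show ?thesis
    by (rule D.group_comm_groupI) (auto simp: Zp2_def add.commute)
qed

lemma carrier_Zp2: "carrier (Zp2 p) = carrier (Zp p) \<times> carrier (Zp p)"
  by (simp add: Zp2_def)

lemma mult_Zp2: "x \<otimes>\<^bsub>Zp2 p\<^esub> y =
    (\<lambda>n. (fst x n + fst y n) mod int p ^ n, \<lambda>n. (snd x n + snd y n) mod int p ^ n)"
  by (simp add: Zp2_def mult_DirProd')

lemma one_Zp2: "\<one>\<^bsub>Zp2 p\<^esub> = (\<lambda>n. 0, \<lambda>n. 0)"
  by (simp add: Zp2_def)

lemma inv_Zp2:
  assumes "0 < p" "z \<in> carrier (Zp2 p)"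
  shows "inv\<^bsub>Zp2 p\<^esub> z = (\<lambda>n. (- fst z n) mod int p ^ n, \<lambda>n. (- snd z n) mod int p ^ n)"
proof -
  interpret comm_group "Zp p" using Zp_comm_group[OF assms(1)] .
  have "group (Zp p)" by standard
  then show ?thesis
    using assms(2) inv_Zp[OF assms(1)] by (cases z) (simp add: Zp2_def)
qed

lemma pow_Zp2:
  assumes "0 < p" "z \<in> carrier (Zp2 p)"
  shows "z [^]\<^bsub>Zp2 p\<^esub> (k::int) = (\<lambda>n. (k * fst z n) mod int p ^ n, \<lambda>n. (k * snd z n) mod int p ^ n)"
proof -
  interpret Z: comm_group "Zp p" using Zp_comm_group[OF assms(1)] .
  interpret comm_group "Zp2 p" using Zp2_comm_group[OF assms(1)] .
  have "fst \<in> hom (Zp2 p) (Zp p)" "snd \<in> hom (Zp2 p) (Zp p)"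
    by (auto simp: hom_def Zp2_def mult_DirProd')
  then have "fst (z [^]\<^bsub>Zp2 p\<^esub> k) = fst z [^]\<^bsub>Zp p\<^esub> k" "snd (z [^]\<^bsub>Zp2 p\<^esub> k) = snd z [^]\<^bsub>Zp p\<^esub> k"
    by (auto intro!: hom_int_pow assms is_group Z.is_group)
  moreover have "fst z \<in> carrier (Zp p)" "snd z \<in> carrier (Zp p)"
    using assms(2) by (auto simp: carrier_Zp2)
  ultimately show ?thesis by (simp add: prod_eq_iff pow_Zp assms(1))
qed

lemma openin_Zp_level: "openin (Zp_topology p) {x \<in> carrier (Zp p). Q (x n)}"
proof -
  have "openin (product_topology (\<lambda>_. discrete_topology UNIV) UNIV) {x :: padic. x n \<in> Collect Q}"
    using openin_continuous_map_preimage[OF continuous_map_product_projection[of n UNIV "\<lambda>_. discrete_topology UNIV"], of "Collect Q"]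
    by simp
  then have "openin (Zp_topology p) ({x. x n \<in> Collect Q} \<inter> carrier (Zp p))"
    unfolding Zp_topology_def by (rule openin_subtopology_Int)
  moreover have "{x. x n \<in> Collect Q} \<inter> carrier (Zp p) = {x \<in> carrier (Zp p). Q (x n)}" by auto
  ultimately show ?thesis by simp
qed

text \<open>
  A basic neighbourhood restricts finitely many coordinates, and each of them is determined by any
  coordinate of larger index.
\<close>

lemma Zp_nbhd:
  assumes U: "openin (Zp_topology p) U" and x: "x \<in> U"
  obtains N where "\<And>y n. y \<in> carrier (Zp p) \<Longrightarrow> N \<le> n \<Longrightarrow> y n = x n \<Longrightarrow> y \<in> U"
proof -
  obtain V where V: "openin (product_topology (\<lambda>_. discrete_topology UNIV) UNIV) V"
    and UV: "U = V \<inter> carrier (Zp p)"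
    using U unfolding Zp_topology_def openin_subtopology by blast
  obtain B where B: "finite {i. B i \<noteq> UNIV}" "x \<in> Pi UNIV B" "Pi UNIV B \<subseteq> V"
    using V x UV unfolding openin_product_topology_alt by (auto simp: PiE_UNIV_domain)
  have xc: "x \<in> carrier (Zp p)" using x UV by blast
  define N where "N = Max (insert 0 {i. B i \<noteq> UNIV})"
  have "y \<in> U" if y: "y \<in> carrier (Zp p)" and n: "N \<le> n" and eq: "y n = x n" for y n
  proof -
    have "y i \<in> B i" for i
    proof (cases "B i = UNIV")
      case False
      then have "i \<le> N" unfolding N_def using B(1) by (intro Max_ge) auto
      then have "y i = x i" using Zp_mod[OF y, of i n] Zp_mod[OF xc, of i n] eq n by simp
      then show ?thesis using B(2) by auto
    qed simp
    then show ?thesis using B(3) y UV by auto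
  qed
  then show thesis by (rule that)
qed

lemma openin_Zp2_level:
  "openin (Zp2_topology p) {z \<in> carrier (Zp2 p). Q (fst z n) (snd z n)}"
  unfolding Zp2_topology_def openin_prod_topology_alt
proof (intro allI impI)
  fix x y assume "(x, y) \<in> {z \<in> carrier (Zp2 p). Q (fst z n) (snd z n)}"
  then have xy: "x \<in> carrier (Zp p)" "y \<in> carrier (Zp p)" "Q (x n) (y n)"
    by (auto simp: carrier_Zp2)
  show "\<exists>U V. openin (Zp_topology p) U \<and> openin (Zp_topology p) V \<and> x \<in> U \<and> y \<in> V \<and>
      U \<times> V \<subseteq> {z \<in> carrier (Zp2 p). Q (fst z n) (snd z n)}"
    by (rule exI[of _ "{x' \<in> carrier (Zp p). x' n = x n}"],
        rule exI[of _ "{y' \<in> carrier (Zp p). y' n = y n}"])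
      (use xy openin_Zp_level[of p "\<lambda>t. t = x n" n] openin_Zp_level[of p "\<lambda>t. t = y n" n]
        in \<open>auto simp: carrier_Zp2\<close>)
qed

lemma Zp2_nbhd:
  assumes U: "openin (Zp2_topology p) U" and z: "z \<in> U"
  obtains N where "\<And>w. w \<in> carrier (Zp2 p) \<Longrightarrow> fst w N = fst z N \<Longrightarrow> snd w N = snd z N \<Longrightarrow> w \<in> U"
proof -
  obtain A B where AB: "openin (Zp_topology p) A" "openin (Zp_topology p) B"
    "fst z \<in> A" "snd z \<in> B" "A \<times> B \<subseteq> U"
    using U z unfolding Zp2_topology_def openin_prod_topology_alt by (metis prod.collapse)
  obtain M where M: "\<And>y n. y \<in> carrier (Zp p) \<Longrightarrow> M \<le> n \<Longrightarrow> y n = fst z n \<Longrightarrow> y \<in> A"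
    using Zp_nbhd[OF AB(1,3)] by blast
  obtain N where N: "\<And>y n. y \<in> carrier (Zp p) \<Longrightarrow> N \<le> n \<Longrightarrow> y n = snd z n \<Longrightarrow> y \<in> B"
    using Zp_nbhd[OF AB(2,4)] by blast
  have "w \<in> U" if "w \<in> carrier (Zp2 p)" "fst w (max M N) = fst z (max M N)" "snd w (max M N) = snd z (max M N)" for w
  proof -
    have "fst w \<in> A" using that by (intro M[of _ "max M N"]) (auto simp: carrier_Zp2)
    moreover have "snd w \<in> B" using that by (intro N[of _ "max M N"]) (auto simp: carrier_Zp2)
    ultimately show ?thesis using AB(5) by (cases w) auto
  qed
  then show thesis by (rule that)
qed

lemma pn_Zp_subgroup:
  assumes "0 < p"
  shows "subgroup (pn_Zp p n) (Zp p)"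
proof -
  interpret comm_group "Zp p" using Zp_comm_group[OF assms] .
  show ?thesis
  proof (rule subgroupI)
    show "pn_Zp p n \<noteq> {}" using one_closed by (auto simp: pn_Zp_def intro!: exI[of _ "\<lambda>_. 0"])
    show "x \<otimes>\<^bsub>Zp p\<^esub> y \<in> pn_Zp p n" if "x \<in> pn_Zp p n" "y \<in> pn_Zp p n" for x y
      using that m_closed[of x y] by (simp add: pn_Zp_def)
    show "inv\<^bsub>Zp p\<^esub> x \<in> pn_Zp p n" if "x \<in> pn_Zp p n" for x
      using that inv_closed[of x] by (simp add: pn_Zp_def inv_Zp assms)
  qed (auto simp: pn_Zp_def)
qed

text \<open>
  An open subgroup contains \<open>p\<^sup>N\<int>\<^sub>p\<close> for some \<open>N\<close>, so an element belongs to it exactly when its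
  residue modulo \<open>p\<^sup>N\<close>, an integer, does; the integers in the subgroup are the multiples of some \<open>p\<^sup>n\<close>.
\<close>

lemma open_subgroups_Zp:
  assumes "prime p"
  shows "open_subgroups (Zp p) (Zp_topology p) = range (pn_Zp p)"
proof (intro equalityI subsetI)
  have p: "0 < p" using assms prime_gt_0_nat by blast
  fix H assume "H \<in> range (pn_Zp p)"
  then obtain n where n: "H = pn_Zp p n" by blast
  have "openin (Zp_topology p) (pn_Zp p n)"
    unfolding pn_Zp_def by (rule openin_Zp_level)
  then show "H \<in> open_subgroups (Zp p) (Zp_topology p)"
    using pn_Zp_subgroup[OF p] by (simp add: n open_subgroups_def)
next
  have p: "0 < p" using assms prime_gt_0_nat by blast
  interpret comm_group "Zp p" using Zp_comm_group[OF p] .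
  fix H assume "H \<in> open_subgroups (Zp p) (Zp_topology p)"
  then have H: "subgroup H (Zp p)" and open': "openin (Zp_topology p) H"
    by (auto simp: open_subgroups_def)
  obtain N where N: "\<And>y. y \<in> carrier (Zp p) \<Longrightarrow> y N = 0 \<Longrightarrow> y \<in> H"
    using Zp_nbhd[OF open' subgroup.one_closed[OF H]] by (metis one_Zp order_refl)
  \<comment> \<open>The integers embed as the powers of this element.\<close>
  let ?g = "Zp_of_int p 1"
  have g: "?g \<in> carrier (Zp p)" using Zp_of_int_mem[OF p] .
  have pow: "?g [^]\<^bsub>Zp p\<^esub> k = Zp_of_int p k" for k :: int
    by (simp add: pow_Zp[OF p g]) (simp add: Zp_of_int_def mod_simps)
  have "?g [^]\<^bsub>Zp p\<^esub> (int p ^ N) \<in> H"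
    unfolding pow by (rule N) (simp_all add: Zp_of_int_mem p, simp add: Zp_of_int_def)
  from exponents_into_subgroup[OF assms H g this]
  obtain n where n: "n \<le> N" and k: "\<And>k::int. ?g [^]\<^bsub>Zp p\<^esub> k \<in> H \<longleftrightarrow> int p ^ n dvd k" by blast
  have "x \<in> H \<longleftrightarrow> x n = 0" if x: "x \<in> carrier (Zp p)" for x
  proof -
    let ?y = "Zp_of_int p (x N)"
    have y: "?y \<in> carrier (Zp p)" using Zp_of_int_mem[OF p] .
    have "inv\<^bsub>Zp p\<^esub> x \<otimes>\<^bsub>Zp p\<^esub> ?y \<in> H"
    proof (rule N)
      show "(inv\<^bsub>Zp p\<^esub> x \<otimes>\<^bsub>Zp p\<^esub> ?y) N = 0"
        using x by (simp add: inv_Zp p) (simp add: Zp_of_int_def mod_simps)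
    qed (use x y in blast)
    then have "x \<in> H \<longleftrightarrow> ?y \<in> H" by (rule mem_subgroup_cong[OF H x y])
    also have "\<dots> \<longleftrightarrow> int p ^ n dvd x N" using k[of "x N"] by (simp add: pow)
    also have "\<dots> \<longleftrightarrow> x n = 0" using Zp_mod[OF x n] by (simp add: dvd_eq_mod_eq_0)
    finally show ?thesis .
  qed
  then have "H = pn_Zp p n"
    using subgroup.mem_carrier[OF H] by (auto simp: pn_Zp_def)
  then show "H \<in> range (pn_Zp p)" by blast
qed

lemma card_lcosets_pn_Zp:
  assumes "0 < p"
  shows "card (lcosets\<^bsub>Zp p\<^esub> pn_Zp p n) = p ^ n"
proof -
  interpret comm_group "Zp p" using Zp_comm_group[OF assms] .
  have "card (lcosets\<^bsub>Zp p\<^esub> pn_Zp p n) = card ((\<lambda>x. x n) ` carrier (Zp p))"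
  proof (rule card_lcosets_eq_card_image[OF pn_Zp_subgroup[OF assms]])
    fix x y assume x: "x \<in> carrier (Zp p)" and y: "y \<in> carrier (Zp p)"
    have "inv\<^bsub>Zp p\<^esub> x \<otimes>\<^bsub>Zp p\<^esub> y \<in> carrier (Zp p)" using x y by blast
    then have "inv\<^bsub>Zp p\<^esub> x \<otimes>\<^bsub>Zp p\<^esub> y \<in> pn_Zp p n \<longleftrightarrow> (y n - x n) mod int p ^ n = 0"
      by (simp add: pn_Zp_def inv_Zp[OF assms x] mod_simps)
    also have "\<dots> \<longleftrightarrow> x n = y n"
      using Zp_mod[OF x order_refl, of n] Zp_mod[OF y order_refl, of n]
      by (metis mod_eq_dvd_iff dvd_eq_mod_eq_0)
    finally show "inv\<^bsub>Zp p\<^esub> x \<otimes>\<^bsub>Zp p\<^esub> y \<in> pn_Zp p n \<longleftrightarrow> x n = y n" .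
  qed
  also have "(\<lambda>x. x n) ` carrier (Zp p) = {0..<int p ^ n}"
  proof (intro equalityI subsetI)
    fix c assume "c \<in> {0..<int p ^ n}"
    then show "c \<in> (\<lambda>x. x n) ` carrier (Zp p)"
      by (intro image_eqI[of _ _ "Zp_of_int p c"] Zp_of_int_mem assms) (simp add: Zp_of_int_def)
  qed (auto simp: carrier_Zp)
  finally show ?thesis by (simp add: nat_power_eq)
qed

lemma pn_Zp_subset_iff:
  assumes "1 < p"
  shows "pn_Zp p n \<subseteq> pn_Zp p i \<longleftrightarrow> i \<le> n"
proof
  assume "i \<le> n"
  then show "pn_Zp p n \<subseteq> pn_Zp p i"
    by (auto simp: pn_Zp_def) (metis Zp_mod mod_0)
next
  assume "pn_Zp p n \<subseteq> pn_Zp p i"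
  moreover have "Zp_of_int p (int p ^ n) \<in> pn_Zp p n"
    using Zp_of_int_mem[of p "int p ^ n"] assms by (simp add: pn_Zp_def) (simp add: Zp_of_int_def)
  ultimately have "int p ^ n mod int p ^ i = 0"
    by (auto simp: pn_Zp_def Zp_of_int_def)
  then have "int p ^ i dvd int p ^ n" by (simp add: dvd_eq_mod_eq_0)
  then show "i \<le> n" using assms by (simp add: int_power_dvd_iff)
qed


section \<open>Cyclic quotients of $\mathbf{Z}_p^2$ and the tree\<close>

definition primitive :: "nat \<Rightarrow> int \<Rightarrow> int \<Rightarrow> bool" where
  "primitive p u v \<longleftrightarrow> \<not> (int p dvd u \<and> int p dvd v)"

lemma primitive_1_0: "prime p \<Longrightarrow> primitive p 1 0"
  using prime_gt_1_nat[of p] by (simp add: primitive_def)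

definition form_kernel :: "nat \<Rightarrow> int \<Rightarrow> int \<Rightarrow> nat \<Rightarrow> (padic \<times> padic) set" where
  "form_kernel p u v n = {z \<in> carrier (Zp2 p). int p ^ n dvd u * fst z n + v * snd z n}"

lemma Zp2_pair_mem: "0 < p \<Longrightarrow> (Zp_of_int p a, Zp_of_int p b) \<in> carrier (Zp2 p)"
  by (simp add: carrier_Zp2 Zp_of_int_mem)

lemma mod_form: "(u * (a mod m) + v * (b mod m)) mod m = (u * a + v * b) mod (m::int)"
  by (rule mod_add_cong) (simp_all add: mod_mult_right_eq)

lemma dvd_mod_form:
  "(m::int) dvd u * (a mod m) + v * (b mod m) \<longleftrightarrow> m dvd u * a + v * b"
  by (simp add: dvd_eq_mod_eq_0 mod_form)

text \<open>
  Membership is a congruence modulo \<open>p\<^sup>n\<close>, so it may be tested on any coordinate of index at least \<open>n\<close>.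
\<close>

lemma form_kernel_level:
  assumes z: "z \<in> carrier (Zp2 p)" and "n \<le> N"
  shows "z \<in> form_kernel p u v n \<longleftrightarrow> int p ^ n dvd u * fst z N + v * snd z N"
proof -
  have "fst z N mod int p ^ n = fst z n" "snd z N mod int p ^ n = snd z n"
    using z \<open>n \<le> N\<close> by (auto simp: carrier_Zp2 intro!: Zp_mod)
  then show ?thesis
    using z dvd_mod_form[of "int p ^ n" u "fst z N" v "snd z N"] by (simp add: form_kernel_def)
qed

lemma pair_mem_form_kernel:
  assumes "0 < p"
  shows "(Zp_of_int p a, Zp_of_int p b) \<in> form_kernel p u v n \<longleftrightarrow> int p ^ n dvd u * a + v * b"
  using Zp2_pair_mem[OF assms, of a b] dvd_mod_form[of "int p ^ n" u a v b]
  by (simp add: form_kernel_def) (simp add: Zp_of_int_def)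

lemma form_kernel_antimono: "m \<le> n \<Longrightarrow> form_kernel p u v n \<subseteq> form_kernel p u v m"
  using form_kernel_level[of _ p m n u v]
  by (auto simp: form_kernel_def intro: dvd_trans[OF le_imp_power_dvd])

lemma form_kernel_0: "form_kernel p u v 0 = carrier (Zp2 p)"
  by (simp add: form_kernel_def)

lemma inv_mult_mem_form_kernel:
  assumes p: "0 < p" and x: "x \<in> carrier (Zp2 p)" and y: "y \<in> carrier (Zp2 p)"
  shows "inv\<^bsub>Zp2 p\<^esub> x \<otimes>\<^bsub>Zp2 p\<^esub> y \<in> form_kernel p u v n \<longleftrightarrow>
    (u * fst x n + v * snd x n) mod int p ^ n = (u * fst y n + v * snd y n) mod int p ^ n"
proof -
  interpret comm_group "Zp2 p" using Zp2_comm_group[OF p] .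
  let ?w = "inv\<^bsub>Zp2 p\<^esub> x \<otimes>\<^bsub>Zp2 p\<^esub> y"
  have w: "?w \<in> carrier (Zp2 p)" using x y by blast
  have "fst ?w n = (fst y n - fst x n) mod int p ^ n" "snd ?w n = (snd y n - snd x n) mod int p ^ n"
    by (simp_all add: mult_Zp2 inv_Zp2[OF p x] mod_simps)
  then have "?w \<in> form_kernel p u v n \<longleftrightarrow> int p ^ n dvd u * (fst y n - fst x n) + v * (snd y n - snd x n)"
    using w by (simp add: form_kernel_def dvd_mod_form)
  also have "\<dots> \<longleftrightarrow> int p ^ n dvd (u * fst y n + v * snd y n) - (u * fst x n + v * snd x n)"
    by (simp add: algebra_simps)
  finally show ?thesis by (metis mod_eq_dvd_iff)
qed

lemma form_kernel_subgroup:
  assumes p: "0 < p"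
  shows "subgroup (form_kernel p u v n) (Zp2 p)"
proof -
  interpret comm_group "Zp2 p" using Zp2_comm_group[OF p] .
  have one: "\<one>\<^bsub>Zp2 p\<^esub> \<in> form_kernel p u v n"
    using one_closed by (simp add: form_kernel_def one_Zp2)
  have diff: "inv\<^bsub>Zp2 p\<^esub> x \<otimes>\<^bsub>Zp2 p\<^esub> y \<in> form_kernel p u v n"
    if "x \<in> form_kernel p u v n" "y \<in> form_kernel p u v n" for x y
    using that inv_mult_mem_form_kernel[OF p, of x y u v n] by (simp add: form_kernel_def)
  have car: "form_kernel p u v n \<subseteq> carrier (Zp2 p)" by (auto simp: form_kernel_def)
  have inv: "inv\<^bsub>Zp2 p\<^esub> x \<in> form_kernel p u v n" if "x \<in> form_kernel p u v n" for x
    using diff[OF that one] subsetD[OF car that] by simp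
  show ?thesis
  proof (rule subgroupI[OF car _ inv])
    fix x y assume xy: "x \<in> form_kernel p u v n" "y \<in> form_kernel p u v n"
    then show "x \<otimes>\<^bsub>Zp2 p\<^esub> y \<in> form_kernel p u v n"
      using diff[OF inv[OF xy(1)] xy(2)] subsetD[OF car xy(1)] by simp
  qed (use one in auto)
qed

lemma form_kernel_open_subgroup:
  assumes "0 < p"
  shows "form_kernel p u v n \<in> open_subgroups (Zp2 p) (Zp2_topology p)"
  using form_kernel_subgroup[OF assms]
    openin_Zp2_level[of p "\<lambda>a b. int p ^ n dvd u * a + v * b" n]
  by (simp add: open_subgroups_def form_kernel_def)

text \<open>
  Primitive forms are surjective: one of the two coefficients is a unit modulo \<open>p\<^sup>n\<close>.
\<close>

lemma primitive_solve:
  assumes p: "prime p" and "primitive p u v"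
  obtains s t where "int p ^ n dvd u * s + v * t - 1"
proof -
  have prime: "prime (int p)" using p by simp
  have unit: "\<exists>s. int p ^ n dvd a * s - 1" if "\<not> int p dvd a" for a
  proof -
    have "coprime (int p ^ n) a" using prime that by (simp add: prime_imp_coprime)
    then have "gcd a (int p ^ n) = 1" by (simp add: coprime_commute)
    moreover obtain s t where "s * a + t * int p ^ n = gcd a (int p ^ n)" using bezout_int by blast
    ultimately have "a * s - 1 = int p ^ n * (- t)" by (simp add: algebra_simps)
    then show ?thesis by (metis dvd_triv_left)
  qed
  show thesis
  proof (cases "int p dvd u")
    case False
    then obtain s where "int p ^ n dvd u * s - 1" using unit by blast
    then show thesis using that[of s 0] by simp
  next
    case True
    then obtain t where "int p ^ n dvd v * t - 1" using unit assms(2) by (auto simp: primitive_def)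
    then show thesis using that[of 0 t] by simp
  qed
qed

lemma card_lcosets_form_kernel:
  assumes p: "prime p" and uv: "primitive p u v"
  shows "card (lcosets\<^bsub>Zp2 p\<^esub> form_kernel p u v n) = p ^ n"
proof -
  have p0: "0 < p" using p prime_gt_0_nat by blast
  interpret comm_group "Zp2 p" using Zp2_comm_group[OF p0] .
  let ?\<chi> = "\<lambda>z::padic \<times> padic. (u * fst z n + v * snd z n) mod int p ^ n"
  have "card (lcosets\<^bsub>Zp2 p\<^esub> form_kernel p u v n) = card (?\<chi> ` carrier (Zp2 p))"
    by (rule card_lcosets_eq_card_image[OF form_kernel_subgroup[OF p0] inv_mult_mem_form_kernel[OF p0]])
  also have "?\<chi> ` carrier (Zp2 p) = {0..<int p ^ n}"
  proof (intro equalityI subsetI)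
    fix c assume c: "c \<in> {0..<int p ^ n}"
    obtain s t where st: "int p ^ n dvd u * s + v * t - 1" using primitive_solve[OF p uv] .
    have "?\<chi> (Zp_of_int p (c * s), Zp_of_int p (c * t)) = (c * (u * s + v * t)) mod int p ^ n"
      by (simp add: Zp_of_int_def mod_form algebra_simps)
    also have "\<dots> = (c * 1) mod int p ^ n"
      using st by (metis mod_eq_dvd_iff mod_mult_right_eq)
    finally have "?\<chi> (Zp_of_int p (c * s), Zp_of_int p (c * t)) = c" using c by simp
    then show "c \<in> ?\<chi> ` carrier (Zp2 p)"
      by (rule image_eqI[OF sym Zp2_pair_mem[OF p0]])
  qed (use p0 in auto)
  finally show ?thesis by (simp add: nat_power_eq)
qed

text \<open>
  A pair on which the form takes the value \<open>1\<close> generates the quotient.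
\<close>

lemma form_kernel_cyclic:
  assumes p: "prime p" and uv: "primitive p u v"
  shows "cyclic_group (Zp2 p Mod form_kernel p u v n)"
proof -
  have p0: "0 < p" using p prime_gt_0_nat by blast
  interpret comm_group "Zp2 p" using Zp2_comm_group[OF p0] .
  obtain s t where st: "int p ^ n dvd u * s + v * t - 1" using primitive_solve[OF p uv] .
  let ?g = "(Zp_of_int p s, Zp_of_int p t)"
  have g: "?g \<in> carrier (Zp2 p)" using Zp2_pair_mem[OF p0] .
  have "inv\<^bsub>Zp2 p\<^esub> z \<otimes>\<^bsub>Zp2 p\<^esub> (?g [^]\<^bsub>Zp2 p\<^esub> (u * fst z n + v * snd z n)) \<in> form_kernel p u v n"
    if z: "z \<in> carrier (Zp2 p)" for z
  proof -
    define k where "k = u * fst z n + v * snd z n"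
    have "fst (?g [^]\<^bsub>Zp2 p\<^esub> k) n = (k * s) mod int p ^ n" "snd (?g [^]\<^bsub>Zp2 p\<^esub> k) n = (k * t) mod int p ^ n"
      by (simp_all add: pow_Zp2[OF p0 g]) (simp_all add: Zp_of_int_def mod_mult_right_eq)
    then have "(u * fst (?g [^]\<^bsub>Zp2 p\<^esub> k) n + v * snd (?g [^]\<^bsub>Zp2 p\<^esub> k) n) mod int p ^ n
        = (k * (u * s + v * t)) mod int p ^ n"
      by (simp add: mod_form algebra_simps)
    also have "\<dots> = (k * 1) mod int p ^ n"
      using st by (metis mod_eq_dvd_iff mod_mult_right_eq)
    finally show ?thesis
      using inv_mult_mem_form_kernel[OF p0 z int_pow_closed[OF g], of k u v n]
      by (simp add: k_def)
  qed
  then show ?thesis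
    using g by (subst cyclic_Mod_iff[OF form_kernel_subgroup[OF p0]]) blast
qed

text \<open>
  Let \<open>g\<close> generate the quotient by \<open>H\<close> and write the two unit vectors as \<open>u\<close> and \<open>v\<close> times \<open>g\<close> modulo \<open>H\<close>.
  Since \<open>H\<close> contains \<open>p\<^sup>N\<int>\<^sub>p\<^sup>2\<close>, any \<open>(x, y)\<close> is then \<open>u x + v y\<close> times \<open>g\<close> modulo \<open>H\<close>, with \<open>x\<close> and \<open>y\<close> replaced
  by their residues modulo \<open>p\<^sup>N\<close>, and the multiples \<open>k g\<close> that lie in \<open>H\<close> are those with \<open>p\<^sup>n\<close> dividing \<open>k\<close>.
  Applying this to \<open>g\<close> itself gives \<open>u g\<^sub>1 + v g\<^sub>2 \<equiv> 1\<close> modulo \<open>p\<^sup>n\<close>, so the form is primitive when \<open>n > 0\<close>.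
\<close>

lemma cyclic_open_subgroup_is_form_kernel:
  assumes p: "prime p" and H: "H \<in> open_subgroups (Zp2 p) (Zp2_topology p)"
    and cyc: "cyclic_group (Zp2 p Mod H)"
  obtains u v n where "primitive p u v" "H = form_kernel p u v n"
proof -
  have p0: "0 < p" using p prime_gt_0_nat by blast
  interpret comm_group "Zp2 p" using Zp2_comm_group[OF p0] .
  have sH: "subgroup H (Zp2 p)" and oH: "openin (Zp2_topology p) H"
    using H by (auto simp: open_subgroups_def)
  obtain N where N: "\<And>w. w \<in> carrier (Zp2 p) \<Longrightarrow> fst w N = 0 \<Longrightarrow> snd w N = 0 \<Longrightarrow> w \<in> H"
    using Zp2_nbhd[OF oH subgroup.one_closed[OF sH]] unfolding one_Zp2 fst_conv snd_conv by metis
  obtain g where g: "g \<in> carrier (Zp2 p)"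
    and gen: "\<And>z. z \<in> carrier (Zp2 p) \<Longrightarrow> \<exists>k::int. inv\<^bsub>Zp2 p\<^esub> z \<otimes>\<^bsub>Zp2 p\<^esub> (g [^]\<^bsub>Zp2 p\<^esub> k) \<in> H"
    using cyc unfolding cyclic_Mod_iff[OF sH] by blast
  have "g [^]\<^bsub>Zp2 p\<^esub> (int p ^ N) \<in> H"
    by (rule N[OF int_pow_closed[OF g]]) (simp_all add: pow_Zp2[OF p0 g])
  from exponents_into_subgroup[OF p sH g this] obtain n where
    n: "n \<le> N" and pow: "\<And>k::int. g [^]\<^bsub>Zp2 p\<^esub> k \<in> H \<longleftrightarrow> int p ^ n dvd k" by blast
  let ?e = "(Zp_of_int p 1, Zp_of_int p 0)" and ?f = "(Zp_of_int p 0, Zp_of_int p 1)"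
  have e: "?e \<in> carrier (Zp2 p)" and f: "?f \<in> carrier (Zp2 p)" using Zp2_pair_mem[OF p0] by auto
  obtain u :: int where u: "inv\<^bsub>Zp2 p\<^esub> ?e \<otimes>\<^bsub>Zp2 p\<^esub> (g [^]\<^bsub>Zp2 p\<^esub> u) \<in> H" using gen[OF e] by blast
  obtain v :: int where v: "inv\<^bsub>Zp2 p\<^esub> ?f \<otimes>\<^bsub>Zp2 p\<^esub> (g [^]\<^bsub>Zp2 p\<^esub> v) \<in> H" using gen[OF f] by blast
  have key: "inv\<^bsub>Zp2 p\<^esub> z \<otimes>\<^bsub>Zp2 p\<^esub> (g [^]\<^bsub>Zp2 p\<^esub> (u * fst z N + v * snd z N)) \<in> H"
    if z: "z \<in> carrier (Zp2 p)" for z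
  proof -
    let ?a = "fst z N" and ?b = "snd z N"
    have 1: "inv\<^bsub>Zp2 p\<^esub> z \<otimes>\<^bsub>Zp2 p\<^esub> (?e [^]\<^bsub>Zp2 p\<^esub> ?a \<otimes>\<^bsub>Zp2 p\<^esub> ?f [^]\<^bsub>Zp2 p\<^esub> ?b) \<in> H"
      by (rule N, use z e f in blast)
        (simp_all add: mult_Zp2 inv_Zp2[OF p0 z] pow_Zp2[OF p0 e] pow_Zp2[OF p0 f],
         simp_all add: Zp_of_int_def mod_simps)
    have 2: "(inv\<^bsub>Zp2 p\<^esub> (?e [^]\<^bsub>Zp2 p\<^esub> ?a) \<otimes>\<^bsub>Zp2 p\<^esub> g [^]\<^bsub>Zp2 p\<^esub> (u * ?a)) \<in> H"
      using subgroup_int_pow_closed[OF sH u, of ?a] e g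
      by (simp add: int_pow_mult_distrib m_comm int_pow_inv int_pow_pow)
    have 3: "(inv\<^bsub>Zp2 p\<^esub> (?f [^]\<^bsub>Zp2 p\<^esub> ?b) \<otimes>\<^bsub>Zp2 p\<^esub> g [^]\<^bsub>Zp2 p\<^esub> (v * ?b)) \<in> H"
      using subgroup_int_pow_closed[OF sH v, of ?b] f g
      by (simp add: int_pow_mult_distrib m_comm int_pow_inv int_pow_pow)
    have "(inv\<^bsub>Zp2 p\<^esub> z \<otimes>\<^bsub>Zp2 p\<^esub> (?e [^]\<^bsub>Zp2 p\<^esub> ?a \<otimes>\<^bsub>Zp2 p\<^esub> ?f [^]\<^bsub>Zp2 p\<^esub> ?b)) \<otimes>\<^bsub>Zp2 p\<^esub>
        ((inv\<^bsub>Zp2 p\<^esub> (?e [^]\<^bsub>Zp2 p\<^esub> ?a) \<otimes>\<^bsub>Zp2 p\<^esub> g [^]\<^bsub>Zp2 p\<^esub> (u * ?a)) \<otimes>\<^bsub>Zp2 p\<^esub>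
         (inv\<^bsub>Zp2 p\<^esub> (?f [^]\<^bsub>Zp2 p\<^esub> ?b) \<otimes>\<^bsub>Zp2 p\<^esub> g [^]\<^bsub>Zp2 p\<^esub> (v * ?b))) \<in> H"
      by (rule subgroup.m_closed[OF sH 1 subgroup.m_closed[OF sH 2 3]])
    then have "inv\<^bsub>Zp2 p\<^esub> z \<otimes>\<^bsub>Zp2 p\<^esub> (g [^]\<^bsub>Zp2 p\<^esub> (u * ?a) \<otimes>\<^bsub>Zp2 p\<^esub> g [^]\<^bsub>Zp2 p\<^esub> (v * ?b)) \<in> H"
      using z e f g by (simp only: cancel_two inv_closed int_pow_closed)
    then show ?thesis using g by (simp only: int_pow_mult)
  qed
  have "z \<in> H \<longleftrightarrow> z \<in> form_kernel p u v n" if z: "z \<in> carrier (Zp2 p)" for z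
  proof -
    have "z \<in> H \<longleftrightarrow> g [^]\<^bsub>Zp2 p\<^esub> (u * fst z N + v * snd z N) \<in> H"
      by (rule mem_subgroup_cong[OF sH z int_pow_closed[OF g] key[OF z]])
    then show ?thesis by (simp add: pow form_kernel_level[OF z n])
  qed
  then have Heq: "H = form_kernel p u v n"
    using subgroup.mem_carrier[OF sH] by (auto simp: form_kernel_def)
  show thesis
  proof (cases "n = 0")
    case True
    \<comment> \<open>The pair found above need not be primitive here, but for \<open>n = 0\<close> every form has the same kernel.\<close>
    have "H = form_kernel p 1 0 0" using Heq True by (simp add: form_kernel_0)
    moreover have "primitive p 1 0" using p by (rule primitive_1_0)
    ultimately show thesis using that by blast
  next
    case False
    let ?k = "u * fst g N + v * snd g N"
    have "g [^]\<^bsub>Zp2 p\<^esub> (?k - 1) \<in> H"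
      using key[OF g] g by (simp add: int_pow_diff m_comm)
    then have "int p ^ n dvd ?k - 1" by (simp add: pow)
    then have d: "int p dvd ?k - 1" using False by (meson dvd_power dvd_trans zero_less_iff_neq_zero)
    have "primitive p u v"
      unfolding primitive_def
    proof
      assume "int p dvd u \<and> int p dvd v"
      then have "int p dvd ?k" by simp
      then have "int p dvd ?k - (?k - 1)" using d by (rule dvd_diff)
      then have "int p dvd 1" by (simp only: diff_diff_eq2) simp
      then show False using prime_gt_1_nat[OF p] by simp
    qed
    then show thesis using that Heq by blast
  qed
qed

lemma tree_eq:
  assumes p: "prime p"
  shows "tree p = {{form_kernel p u v n} | u v n. primitive p u v}"
proof -
  have p0: "0 < p" using p prime_gt_0_nat by blast
  interpret comm_group "Zp2 p" using Zp2_comm_group[OF p0] .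
  show ?thesis
    unfolding tree_def gsets_eq
    using form_kernel_open_subgroup[OF p0] form_kernel_cyclic[OF p]
      cyclic_open_subgroup_is_form_kernel[OF p]
    by (auto simp: image_iff) (metis)
qed


text \<open>
  If the determinant of two forms vanishes modulo \<open>m\<close> and the first one is primitive, the second is a
  multiple of the first.
\<close>

lemma proportional_forms_dvd:
  fixes m :: int
  assumes "m dvd u * s + v * t - 1" and "m dvd u * v' - u' * v" and "m dvd u * a + v * b"
  shows "m dvd u' * a + v' * b"
proof -
  have "u' * a + v' * b = (s * u' + t * v') * (u * a + v * b) + (s * b - t * a) * (u * v' - u' * v)
      - (u' * a + v' * b) * (u * s + v * t - 1)"
    by (simp add: algebra_simps)
  also have "m dvd \<dots>" 
    by (rule dvd_diff[OF dvd_add[OF dvd_mult[OF assms(3)] dvd_mult[OF assms(2)]] dvd_mult[OF assms(1)]])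
  finally show ?thesis .
qed

text \<open>
  This is what makes parents unique: a kernel determines its overkernels.  The vector \<open>(-v, u)\<close> lies in the
  kernel of the first form, so it lies in that of the second, which says that the determinant of the
  two forms vanishes modulo \<open>p\<^sup>m\<close>; the forms are then proportional to each other.
\<close>

lemma form_kernel_subset_imp_eq:
  assumes p: "prime p" and uv: "primitive p u v" and uv': "primitive p u' v'"
    and sub: "form_kernel p u v n \<subseteq> form_kernel p u' v' m"
  shows "form_kernel p u' v' m = form_kernel p u v m"
proof -
  have p0: "0 < p" using p prime_gt_0_nat by blast
  have "(Zp_of_int p (- v), Zp_of_int p u) \<in> form_kernel p u v n"
    by (simp add: pair_mem_form_kernel[OF p0])
  then have "(Zp_of_int p (- v), Zp_of_int p u) \<in> form_kernel p u' v' m" using sub by blast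
  then have det: "int p ^ m dvd u * v' - u' * v" by (simp add: pair_mem_form_kernel[OF p0] mult.commute)
  then have "int p ^ m dvd - (u * v' - u' * v)" by (simp only: dvd_minus_iff)
  then have det': "int p ^ m dvd u' * v - u * v'" by simp
  obtain s t where st: "int p ^ m dvd u * s + v * t - 1" using primitive_solve[OF p uv] .
  obtain s' t' where st': "int p ^ m dvd u' * s' + v' * t' - 1" using primitive_solve[OF p uv'] .
  show ?thesis
    using proportional_forms_dvd[OF st det] proportional_forms_dvd[OF st' det']
    by (auto simp: form_kernel_def)
qed

text \<open>
  Changing \<open>(u, v)\<close> by \<open>p\<^sup>n (e, f)\<close> does not affect the form modulo \<open>p\<^sup>n\<close>.  Modulo \<open>p\<^sup>n\<^sup>+\<^sup>1\<close> it changes the value at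
  \<open>(-v, u)\<close> from \<open>0\<close> to \<open>p\<^sup>n (f u - e v)\<close>, so the kernel changes as soon as \<open>p\<close> does not divide \<open>f u - e v\<close>.
\<close>

lemma form_kernel_two_children:
  assumes p: "prime p" and uv: "primitive p u v"
  obtains u' v' where "primitive p u' v'" "form_kernel p u' v' (Suc n) \<subseteq> form_kernel p u v n"
    "form_kernel p u' v' (Suc n) \<noteq> form_kernel p u v (Suc n)"
proof -
  have p0: "0 < p" using p prime_gt_0_nat by blast
  obtain e f where ef: "\<not> int p dvd f * u - e * v"
  proof (cases "int p dvd u")
    case True
    then show thesis using uv that[of 0 "-1"] by (simp add: primitive_def)
  next
    case False
    then show thesis using that[of 1 0] by simp
  qed
  let ?u = "u + int p ^ n * e" and ?v = "v + int p ^ n * f"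
  have "primitive p ?u ?v"
    unfolding primitive_def
  proof
    assume "int p dvd ?u \<and> int p dvd ?v"
    then have "int p dvd f * ?u - e * ?v" by simp
    then show False using ef by (simp add: algebra_simps)
  qed
  moreover have "form_kernel p ?u ?v (Suc n) \<subseteq> form_kernel p u v n"
  proof
    fix z assume z: "z \<in> form_kernel p ?u ?v (Suc n)"
    then have "z \<in> form_kernel p ?u ?v n" using form_kernel_antimono[of n "Suc n"] by auto
    then have zc: "z \<in> carrier (Zp2 p)" and "int p ^ n dvd ?u * fst z n + ?v * snd z n"
      by (auto simp: form_kernel_def)
    then have "int p ^ n dvd (u * fst z n + v * snd z n) + int p ^ n * (e * fst z n + f * snd z n)"
      by (simp add: algebra_simps)
    then show "z \<in> form_kernel p u v n" using zc by (simp add: form_kernel_def dvd_add_left_iff)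
  qed
  moreover have "form_kernel p ?u ?v (Suc n) \<noteq> form_kernel p u v (Suc n)"
  proof
    assume eq: "form_kernel p ?u ?v (Suc n) = form_kernel p u v (Suc n)"
    have "(Zp_of_int p (- v), Zp_of_int p u) \<in> form_kernel p u v (Suc n)"
      by (simp add: pair_mem_form_kernel[OF p0])
    then have "int p ^ Suc n dvd ?u * (- v) + ?v * u"
      unfolding eq[symmetric] pair_mem_form_kernel[OF p0] .
    then have "int p ^ n * int p dvd int p ^ n * (f * u - e * v)"
      by (simp add: algebra_simps)
    then show False using ef p0 by simp
  qed
  ultimately show thesis by (rule that)
qed

lemma treeE:
  assumes "prime p" "T \<in> tree p"
  obtains u v n where "primitive p u v" "T = {form_kernel p u v n}"
  using assms(2) unfolding tree_eq[OF assms(1)] by blast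

lemma treeI: "prime p \<Longrightarrow> primitive p u v \<Longrightarrow> {form_kernel p u v n} \<in> tree p"
  by (subst tree_eq) blast+

lemma gset_size_form_kernel:
  assumes "prime p" "primitive p u v"
  shows "gset_size (Zp2 p) {form_kernel p u v n} = p ^ n"
  by (simp add: gset_size_def card_lcosets_form_kernel assms)

lemma gset_le_form_kernel:
  assumes "0 < p"
  shows "gset_le (Zp2 p) {form_kernel p u v m} {form_kernel p u' v' n} \<longleftrightarrow>
    form_kernel p u' v' n \<subseteq> form_kernel p u v m"
proof -
  interpret comm_group "Zp2 p" using Zp2_comm_group[OF assms] .
  show ?thesis
    by (simp add: gset_le_def gmaps_nonempty_iff form_kernel_subgroup assms)
qed

text \<open>
  Edges of the tree are undirected; this is the relation oriented away from the root.
\<close>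

definition child :: "nat \<Rightarrow> vertex \<Rightarrow> vertex \<Rightarrow> bool" where
  "child p U T \<longleftrightarrow> U \<in> tree p \<and> T \<in> tree p \<and> gset_le (Zp2 p) U T \<and>
     gset_size (Zp2 p) T = p * gset_size (Zp2 p) U"

lemma tree_edge_iff: "tree_edge p U T \<longleftrightarrow> child p U T \<or> child p T U"
  by (auto simp: tree_edge_def child_def)

lemma child_form_kernel_iff:
  assumes p: "prime p" and uv: "primitive p u v" and uv': "primitive p u' v'"
  shows "child p {form_kernel p u v m} {form_kernel p u' v' n} \<longleftrightarrow>
    n = Suc m \<and> form_kernel p u' v' n \<subseteq> form_kernel p u v m"
proof -
  have p0: "0 < p" and p1: "1 < p" using p prime_gt_0_nat prime_gt_1_nat by blast+
  have "p ^ n = p * p ^ m \<longleftrightarrow> n = Suc m" using p1 power_inject_exp[OF p1, of n "Suc m"] by simp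
  then show ?thesis
    by (auto simp: child_def treeI assms gset_le_form_kernel[OF p0] gset_size_form_kernel)
qed

lemma tree_root_eq:
  assumes "prime p"
  shows "tree_root p = {form_kernel p 1 0 0}"
proof -
  have p0: "0 < p" using assms prime_gt_0_nat by blast
  interpret comm_group "Zp2 p" using Zp2_comm_group[OF p0] .
  show ?thesis
    unfolding tree_root_def form_kernel_0[of p 1 0, symmetric]
    by (rule gset_class_eq[OF form_kernel_open_subgroup[OF p0]])
qed

lemma gset_size_tree:
  assumes "prime p" "T \<in> tree p"
  obtains n where "gset_size (Zp2 p) T = p ^ n"
proof -
  obtain u v n where "primitive p u v" "T = {form_kernel p u v n}" using treeE[OF assms] .
  then have "gset_size (Zp2 p) T = p ^ n" by (simp add: gset_size_form_kernel assms(1))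
  then show thesis by (rule that)
qed

lemma tree_root: "prime p \<Longrightarrow> tree_root p \<in> tree p"
  by (simp add: tree_root_eq treeI primitive_1_0)

lemma gset_size_root: "prime p \<Longrightarrow> gset_size (Zp2 p) (tree_root p) = 1"
  by (simp add: tree_root_eq gset_size_form_kernel primitive_1_0)

lemma gset_size_1_imp_root:
  assumes p: "prime p" and T: "T \<in> tree p" and size: "gset_size (Zp2 p) T = 1"
  shows "T = tree_root p"
proof -
  obtain u v n where uv: "primitive p u v" and T: "T = {form_kernel p u v n}" using treeE[OF p T] .
  have "p ^ n = p ^ 0" using size unfolding T gset_size_form_kernel[OF p uv] by simp
  then have "n = 0" by (simp only: power_inject_exp[OF prime_gt_1_nat[OF p]])
  then show ?thesis by (simp add: T tree_root_eq[OF p] form_kernel_0)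
qed

lemma parent_unique:
  assumes p: "prime p" and "child p U T" "child p U' T"
  shows "U = U'"
proof -
  have tree: "U \<in> tree p" "U' \<in> tree p" "T \<in> tree p" using assms(2,3) by (auto simp: child_def)
  obtain u v n where uv: "primitive p u v" and T: "T = {form_kernel p u v n}"
    using treeE[OF p tree(3)] .
  obtain a b m where ab: "primitive p a b" and U: "U = {form_kernel p a b m}"
    using treeE[OF p tree(1)] .
  obtain a' b' m' where ab': "primitive p a' b'" and U': "U' = {form_kernel p a' b' m'}"
    using treeE[OF p tree(2)] .
  have n: "n = Suc m" and sub: "form_kernel p u v n \<subseteq> form_kernel p a b m"
    using assms(2) unfolding T U child_form_kernel_iff[OF p ab uv] by auto
  have n': "n = Suc m'" and sub': "form_kernel p u v n \<subseteq> form_kernel p a' b' m'"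
    using assms(3) unfolding T U' child_form_kernel_iff[OF p ab' uv] by auto
  have "m' = m" using n n' by simp
  then show ?thesis
    unfolding U U' form_kernel_subset_imp_eq[OF p uv ab sub] form_kernel_subset_imp_eq[OF p uv ab' sub']
    by simp
qed

lemma parent_exists:
  assumes p: "prime p" and T: "T \<in> tree p" and size: "gset_size (Zp2 p) T = p ^ Suc n"
  obtains U where "child p U T"
proof -
  obtain u v m where uv: "primitive p u v" and T: "T = {form_kernel p u v m}" using treeE[OF p T] .
  have "m = Suc n" using size prime_gt_1_nat[OF p] power_inject_exp[of p m "Suc n"]
    by (simp add: T gset_size_form_kernel[OF p uv])
  then have "child p {form_kernel p u v n} T"
    by (simp add: T child_form_kernel_iff[OF p uv uv] form_kernel_antimono)
  then show thesis by (rule that)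
qed

lemma two_children:
  assumes p: "prime p" and T: "T \<in> tree p"
  obtains C C' where "child p T C" "child p T C'" "C \<noteq> C'"
proof -
  obtain u v n where uv: "primitive p u v" and T: "T = {form_kernel p u v n}" using treeE[OF p T] .
  obtain u' v' where uv': "primitive p u' v'" and sub: "form_kernel p u' v' (Suc n) \<subseteq> form_kernel p u v n"
    and ne: "form_kernel p u' v' (Suc n) \<noteq> form_kernel p u v (Suc n)"
    using form_kernel_two_children[OF p uv] .
  have "child p T {form_kernel p u' v' (Suc n)}" "child p T {form_kernel p u v (Suc n)}"
    using sub by (simp_all add: T child_form_kernel_iff p uv uv' form_kernel_antimono)
  then show thesis using ne that by blast
qed


section \<open>Paths and balls on the boundary\<close>

lemma path_size:
  assumes "prime p" and "x 0 = tree_root p" and "\<And>n. child p (x n) (x (Suc n))"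
  shows "gset_size (Zp2 p) (x n) = p ^ n"
proof (induction n)
  case 0
  then show ?case by (simp add: assms gset_size_root)
next
  case (Suc n)
  then show ?case using assms(3)[of n] by (simp add: child_def)
qed

text \<open>
  A path without backtracking that starts at the root never turns back towards it: it cannot ascend
  from the root, and ascending right after a descent would lead to the unique parent, which is the
  vertex it came from.
\<close>

lemma P1_iff:
  assumes p: "prime p"
  shows "x \<in> P1 p \<longleftrightarrow> x 0 = tree_root p \<and> (\<forall>n. child p (x n) (x (Suc n)))"
proof
  assume x: "x \<in> P1 p"
  then have x0: "x 0 = tree_root p" and edge: "\<And>n. child p (x n) (x (Suc n)) \<or> child p (x (Suc n)) (x n)"
    and nb: "\<And>n. x (Suc (Suc n)) \<noteq> x n"
    by (auto simp: P1_def tree_edge_iff)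
  have "child p (x n) (x (Suc n))" for n
  proof (induction n)
    case 0
    have "\<not> child p (x 1) (x 0)"
      using prime_gt_1_nat[OF p] by (auto simp: child_def x0 gset_size_root[OF p])
    then show ?case using edge[of 0] by simp
  next
    case (Suc n)
    then have "\<not> child p (x (Suc (Suc n))) (x (Suc n))" using nb parent_unique[OF p] by blast
    then show ?case using edge by blast
  qed
  then show "x 0 = tree_root p \<and> (\<forall>n. child p (x n) (x (Suc n)))" using x0 by blast
next
  assume x: "x 0 = tree_root p \<and> (\<forall>n. child p (x n) (x (Suc n)))"
  then have size: "gset_size (Zp2 p) (x n) = p ^ n" for n using path_size[OF p, of x n] by blast
  have "x (Suc (Suc n)) \<noteq> x n" for n
  proof
    assume "x (Suc (Suc n)) = x n"
    then have "p ^ Suc (Suc n) = p ^ n" by (simp only: size[symmetric])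
    then show False by (simp only: power_inject_exp[OF prime_gt_1_nat[OF p]])
  qed
  then show "x \<in> P1 p" using x by (auto simp: P1_def tree_edge_iff)
qed

lemma P1_size: "prime p \<Longrightarrow> x \<in> P1 p \<Longrightarrow> gset_size (Zp2 p) (x n) = p ^ n"
  using path_size P1_iff by blast

lemma P1_child: "prime p \<Longrightarrow> x \<in> P1 p \<Longrightarrow> child p (x n) (x (Suc n))"
  using P1_iff by blast

lemma P1_tree: "prime p \<Longrightarrow> x \<in> P1 p \<Longrightarrow> x n \<in> tree p"
  using P1_child[of p x n] by (simp add: child_def)

lemma P1_level_unique:
  assumes p: "prime p" and xy: "x \<in> P1 p" "y \<in> P1 p" and eq: "x m = y n"
  shows "m = n"
proof -
  have "p ^ m = p ^ n" using P1_size[OF p xy(1), of m] P1_size[OF p xy(2), of n] eq by simp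
  then show ?thesis by (simp only: power_inject_exp[OF prime_gt_1_nat[OF p]])
qed

lemma finite_path_to:
  assumes p: "prime p" and "T \<in> tree p" and "gset_size (Zp2 p) T = p ^ n"
  shows "\<exists>x. x 0 = tree_root p \<and> (\<forall>i<n. child p (x i) (x (Suc i))) \<and> x n = T"
  using assms(2,3)
proof (induction n arbitrary: T)
  case 0
  then have "T = tree_root p" using gset_size_1_imp_root[OF p] by simp
  then show ?case by (intro exI[of _ "\<lambda>_. T"]) simp
next
  case (Suc n)
  obtain U where U: "child p U T" using parent_exists[OF p Suc.prems] .
  then have "gset_size (Zp2 p) T = p * gset_size (Zp2 p) U" unfolding child_def by blast
  then have "p * gset_size (Zp2 p) U = p * p ^ n" using Suc.prems(2) by (metis power_Suc)
  then have "gset_size (Zp2 p) U = p ^ n" using prime_gt_0_nat[OF p] by simp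
  then obtain x where x: "x 0 = tree_root p" "\<forall>i<n. child p (x i) (x (Suc i))" "x n = U"
    using Suc.IH[of U] U by (auto simp: child_def)
  then show ?case using U by (intro exI[of _ "x(Suc n := T)"]) (auto simp: less_Suc_eq)
qed

text \<open>
  Ascend from \<open>T\<close> to the root along parents, and continue below \<open>T\<close> by choosing children.
\<close>

lemma path_through:
  assumes p: "prime p" and T: "T \<in> tree p" and size: "gset_size (Zp2 p) T = p ^ n"
  obtains x where "x \<in> P1 p" "x n = T"
proof -
  obtain x where x: "x 0 = tree_root p" "\<And>i. i < n \<Longrightarrow> child p (x i) (x (Suc i))" "x n = T"
    using finite_path_to[OF assms] by blast
  define c where "c U = (SOME C. child p U C)" for U
  have c: "child p U (c U)" if "U \<in> tree p" for U
    unfolding c_def using two_children[OF p that] by (metis someI)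
  have iter: "(c ^^ k) T \<in> tree p" for k
    using T c by (induction k) (auto simp: child_def)
  define y where "y i = (if i \<le> n then x i else (c ^^ (i - n)) T)" for i
  have ge: "y i = (c ^^ (i - n)) T" if "n \<le> i" for i
    using that x(3) by (cases "i = n") (auto simp: y_def)
  have "child p (y i) (y (Suc i))" for i
  proof (cases "i < n")
    case True
    then show ?thesis using x(2) by (simp add: y_def)
  next
    case False
    then have "y (Suc i) = c (y i)" by (simp add: ge Suc_diff_le)
    then show ?thesis using c[OF iter] False by (simp add: ge)
  qed
  then have "y \<in> P1 p" using x(1) by (simp add: P1_iff[OF p] y_def)
  moreover have "y n = T" by (simp add: ge)
  ultimately show thesis by (rule that)
qed

lemma paths_agree_below:
  assumes p: "prime p" and xy: "x \<in> P1 p" "y \<in> P1 p" and "x n = y n" and "m \<le> n"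
  shows "x m = y m"
  using \<open>m \<le> n\<close>
proof (induction rule: inc_induct)
  case base
  then show ?case by (rule assms)
next
  case (step k)
  have "child p (x k) (x (Suc k))" "child p (y k) (x (Suc k))"
    using P1_child[OF p xy(1), of k] P1_child[OF p xy(2), of k] step by simp_all
  then show ?case by (rule parent_unique[OF p])
qed

text \<open>
  The partner of \<open>x\<close> in the lower bound for Lipschitz constants.  It exists since \<open>x n\<close> has a second child.
\<close>

lemma path_leaving_before:
  assumes p: "prime p" and x: "x \<in> P1 p"
  obtains y where "y \<in> P1 p" "y n = x n" "y (Suc n) \<noteq> x (Suc n)"
proof -
  obtain C where C: "child p (x n) C" "C \<noteq> x (Suc n)"
    using two_children[OF p P1_tree[OF p x]] by metis
  then have "C \<in> tree p" "gset_size (Zp2 p) C = p ^ Suc n"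
    by (simp_all add: child_def P1_size[OF p x])
  then obtain y where y: "y \<in> P1 p" "y (Suc n) = C" by (rule path_through[OF p])
  have "child p (y n) C" using P1_child[OF p y(1), of n] y(2) by simp
  then have "y n = x n" using C(1) by (rule parent_unique[OF p])
  then show thesis using that y C by simp
qed

text \<open>
  Edges are unordered pairs, but the sizes of the two ends reveal at which time a path runs through an
  edge.  So a common edge is used by both paths at the same time, and it is enough to compare the ends
  farther from the root, since these determine the other ones.
\<close>

lemma common_edges:
  assumes p: "prime p" and x: "x \<in> P1 p" and y: "y \<in> P1 p"
  shows "card (path_edges x \<inter> path_edges y) = card {n. x (Suc n) = y (Suc n)}"
proof -
  let ?e = "\<lambda>n. {x n, x (Suc n)}"
  have same: "m = n \<and> z (Suc m) = w (Suc n)"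
    if z: "z \<in> P1 p" and w: "w \<in> P1 p" and eq: "{z m, z (Suc m)} = {w n, w (Suc n)}" for z w m n
  proof -
    from eq consider "z m = w n" "z (Suc m) = w (Suc n)" | "z m = w (Suc n)" "z (Suc m) = w n"
      by (auto simp: doubleton_eq_iff)
    then show ?thesis
    proof cases
      case 1
      then show ?thesis using P1_level_unique[OF p z w, of m n] by simp
    next
      case 2
      then have "m = Suc n" "Suc m = n" by (auto dest: P1_level_unique[OF p z w])
      then show ?thesis by simp
    qed
  qed
  have common: "path_edges x \<inter> path_edges y = ?e ` {n. x (Suc n) = y (Suc n)}"
  proof (intro equalityI subsetI)
    fix E assume "E \<in> path_edges x \<inter> path_edges y"
    then obtain m n where E: "E = ?e m" "E = {y n, y (Suc n)}"
      unfolding path_edges_def by blast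
    then have "x (Suc m) = y (Suc m)" using same[OF x y] by metis
    then show "E \<in> ?e ` {n. x (Suc n) = y (Suc n)}" using E by blast
  next
    fix E assume "E \<in> ?e ` {n. x (Suc n) = y (Suc n)}"
    then obtain n where n: "E = ?e n" "x (Suc n) = y (Suc n)" by blast
    then have "x n = y n" using paths_agree_below[OF p x y n(2), of n] by simp
    then show "E \<in> path_edges x \<inter> path_edges y" using n by (auto simp: path_edges_def)
  qed
  have "inj_on ?e {n. x (Suc n) = y (Suc n)}" using same[OF x x] by (intro inj_onI) blast
  then show ?thesis unfolding common by (rule card_image)
qed

lemma P1_dist_first_difference:
  assumes p: "prime p" and xy: "x \<in> P1 p" "y \<in> P1 p" and n: "x n = y n" "x (Suc n) \<noteq> y (Suc n)"
  shows "P1_dist p x y = (1 / real p) ^ n"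
proof -
  have "{m. x (Suc m) = y (Suc m)} = {..<n}"
  proof (intro equalityI subsetI)
    fix m assume "m \<in> {m. x (Suc m) = y (Suc m)}"
    then have "\<not> Suc n \<le> Suc m" using paths_agree_below[OF p xy, of "Suc m" "Suc n"] n(2) by blast
    then show "m \<in> {..<n}" by simp
  next
    fix m assume "m \<in> {..<n}"
    then show "m \<in> {m. x (Suc m) = y (Suc m)}" using paths_agree_below[OF p xy n(1), of "Suc m"] by simp
  qed
  moreover have "x \<noteq> y" using n(2) by auto
  ultimately show ?thesis by (simp add: P1_dist_def common_edges[OF p xy])
qed

lemma P1_dist_le_iff:
  assumes p: "prime p" and xy: "x \<in> P1 p" "y \<in> P1 p"
  shows "P1_dist p x y \<le> (1 / real p) ^ n \<longleftrightarrow> x n = y n"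
proof (cases "x = y")
  case True
  then show ?thesis by (simp add: P1_dist_def)
next
  case False
  \<comment> \<open>Both paths start at the root, so the first difference occurs at a positive time.\<close>
  define d where "d = (LEAST m. x m \<noteq> y m)"
  have "\<exists>m. x m \<noteq> y m" using False by blast
  then have d: "x d \<noteq> y d" unfolding d_def by (rule LeastI_ex)
  have "x 0 = y 0" using xy by (simp add: P1_def)
  then obtain k where k: "d = Suc k" using d by (cases d) auto
  have xk: "x k = y k" using not_less_Least[of k "\<lambda>m. x m \<noteq> y m"] k unfolding d_def by auto
  have "P1_dist p x y = (1 / real p) ^ k"
    using P1_dist_first_difference[OF p xy xk] d k by simp
  moreover have "(1 / real p) ^ k \<le> (1 / real p) ^ n \<longleftrightarrow> n \<le> k"
    using prime_gt_1_nat[OF p] by (intro power_decreasing_iff) auto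
  moreover have "x n = y n \<longleftrightarrow> n \<le> k"
  proof
    assume "x n = y n"
    then have "\<not> Suc k \<le> n" using paths_agree_below[OF p xy, of n "Suc k"] d k by blast
    then show "n \<le> k" by simp
  qed (rule paths_agree_below[OF p xy xk])
  ultimately show ?thesis by simp
qed

lemma paths_through_vertex_ball:
  assumes p: "prime p" and T: "T \<in> tree p" and size: "gset_size (Zp2 p) T = p ^ n"
  shows "{x \<in> P1 p. x n = T} \<in> P1_balls p"
proof -
  obtain x where x: "x \<in> P1 p" "x n = T" using path_through[OF assms] .
  have "{y \<in> P1 p. y n = T} = {y \<in> P1 p. P1_dist p x y \<le> (1 / real p) ^ n}"
    using P1_dist_le_iff[OF p x(1)] x(2) by auto
  moreover have "0 < (1 / real p) ^ n" using prime_gt_0_nat[OF p] by simp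
  ultimately show ?thesis unfolding P1_balls_def using x(1) by blast
qed


section \<open>Integral polynomials, ghost components and Dwork's lemma\<close>

lemma lookup_of_nat_mult:
  fixes f :: "'m::monoid_add \<Rightarrow>\<^sub>0 int"
  shows "Poly_Mapping.lookup (of_nat n * f) m = int n * Poly_Mapping.lookup f m"
  by (induction n) (simp_all add: lookup_add algebra_simps)

lemma poly2_torsion_free:
  fixes f g :: "'i poly2"
  assumes "of_nat n * f = of_nat n * g" and "0 < n"
  shows "f = g"
proof (rule poly_mapping_eqI)
  fix m
  have "int n * Poly_Mapping.lookup f m = int n * Poly_Mapping.lookup g m"
    using assms(1) by (metis lookup_of_nat_mult)
  then show "Poly_Mapping.lookup f m = Poly_Mapping.lookup g m"
    using \<open>0 < n\<close> by simp
qed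

lemma sum_single_lookup:
  "(\<Sum>m\<in>Poly_Mapping.keys f. Poly_Mapping.single m (Poly_Mapping.lookup f m)) = f"
proof (rule poly_mapping_eqI)
  fix k
  show "Poly_Mapping.lookup (\<Sum>m\<in>Poly_Mapping.keys f. Poly_Mapping.single m (Poly_Mapping.lookup f m)) k
          = Poly_Mapping.lookup f k"
    by (cases "k \<in> Poly_Mapping.keys f")
       (simp_all add: lookup_sum lookup_single when_def in_keys_iff)
qed

definition monomial_value :: "('v \<Rightarrow> 'r) \<Rightarrow> ('v \<Rightarrow>\<^sub>0 nat) \<Rightarrow> 'r::comm_ring_1" where
  "monomial_value \<rho> m = (\<Prod>v\<in>Poly_Mapping.keys m. \<rho> v ^ Poly_Mapping.lookup m v)"

text \<open>
  Values of monomials and, below, of polynomials are computed over any finite set of indices that is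
  large enough, so that two arguments with different supports can be treated together.
\<close>

lemma monomial_value_superset:
  assumes "finite A" "Poly_Mapping.keys m \<subseteq> A"
  shows "monomial_value \<rho> m = (\<Prod>v\<in>A. \<rho> v ^ Poly_Mapping.lookup m v)"
  unfolding monomial_value_def
  by (rule prod.mono_neutral_left) (use assms in \<open>auto simp: in_keys_iff\<close>)

lemma monomial_value_add:
  "monomial_value \<rho> (m + m') = monomial_value \<rho> m * monomial_value \<rho> m'"
proof -
  let ?A = "Poly_Mapping.keys m \<union> Poly_Mapping.keys m'"
  have "monomial_value \<rho> (m + m') = (\<Prod>v\<in>?A. \<rho> v ^ Poly_Mapping.lookup (m + m') v)"
    by (rule monomial_value_superset) (simp_all add: keys_add)
  also have "\<dots> = (\<Prod>v\<in>?A. \<rho> v ^ Poly_Mapping.lookup m v) * (\<Prod>v\<in>?A. \<rho> v ^ Poly_Mapping.lookup m' v)"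
    by (simp add: lookup_add power_add prod.distrib)
  also have "\<dots> = monomial_value \<rho> m * monomial_value \<rho> m'"
    by (simp add: monomial_value_superset[of ?A])
  finally show ?thesis .
qed

lemma peval_superset:
  assumes "finite A" "Poly_Mapping.keys f \<subseteq> A"
  shows "peval \<rho> f = (\<Sum>m\<in>A. of_int (Poly_Mapping.lookup f m) * monomial_value \<rho> m)"
  unfolding peval_def monomial_value_def
  by (rule sum.mono_neutral_left) (use assms in \<open>auto simp: in_keys_iff\<close>)

lemma peval_add: "peval \<rho> (f + g) = peval \<rho> f + peval \<rho> g"
proof -
  let ?A = "Poly_Mapping.keys f \<union> Poly_Mapping.keys g"
  show ?thesis
    by (simp add: peval_superset[of ?A] keys_add lookup_add algebra_simps sum.distrib)
qed

lemma peval_single: "peval \<rho> (Poly_Mapping.single m c) = of_int c * monomial_value \<rho> m"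
  by (subst peval_superset[of "{m}"]) auto

lemma peval_0: "peval \<rho> 0 = 0"
  by (simp add: peval_def)

lemma peval_1: "peval \<rho> 1 = 1"
  using peval_single[of \<rho> 0 1] by (simp add: monomial_value_def)

lemma peval_sum: "peval \<rho> (sum f A) = (\<Sum>a\<in>A. peval \<rho> (f a))"
  by (induction A rule: infinite_finite_induct) (simp_all add: peval_0 peval_add)

lemma peval_mult: "peval \<rho> (f * g) = peval \<rho> f * peval \<rho> g"
proof -
  let ?t = "\<lambda>f m. Poly_Mapping.single m (Poly_Mapping.lookup f m)"
  have "f * g = (\<Sum>m\<in>Poly_Mapping.keys f. ?t f m) * (\<Sum>m\<in>Poly_Mapping.keys g. ?t g m)"
    by (simp add: sum_single_lookup)
  also have "peval \<rho> \<dots> = (\<Sum>m\<in>Poly_Mapping.keys f. \<Sum>m'\<in>Poly_Mapping.keys g.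
      peval \<rho> (?t f m) * peval \<rho> (?t g m'))"
    by (simp add: sum_product peval_sum mult_single peval_single monomial_value_add algebra_simps)
  also have "\<dots> = peval \<rho> (\<Sum>m\<in>Poly_Mapping.keys f. ?t f m) * peval \<rho> (\<Sum>m\<in>Poly_Mapping.keys g. ?t g m)"
    by (simp add: peval_sum sum_product)
  finally show ?thesis by (simp add: sum_single_lookup)
qed

lemma peval_power: "peval \<rho> (f ^ n) = peval \<rho> f ^ n"
  by (induction n) (simp_all add: peval_1 peval_mult)

lemma peval_prod: "peval \<rho> (prod f A) = (\<Prod>a\<in>A. peval \<rho> (f a))"
  by (induction A rule: infinite_finite_induct) (simp_all add: peval_1 peval_mult)

lemma peval_of_nat: "peval \<rho> (of_nat n) = of_nat n"
  by (induction n) (simp_all add: peval_0 peval_1 peval_add)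

lemma peval_of_int:
  fixes \<rho> :: "'i + 'i \<Rightarrow> 'r::comm_ring_1"
  shows "peval \<rho> (of_int n) = of_int n"
proof -
  have "(of_int n :: 'i poly2) = Poly_Mapping.single 0 n"
    by (subst single_of_int[symmetric]) simp
  then show ?thesis by (simp add: peval_single monomial_value_def)
qed

lemma peval_pvar: "peval \<rho> (pvar v) = \<rho> v"
  unfolding pvar_def by (simp add: peval_single monomial_value_def)

text \<open>
  Substitution followed by evaluation.  Polynomials over \<open>\<int>\<close> are themselves a ring in which to evaluate,
  so \<open>peval \<sigma>\<close> also covers substitutions.
\<close>

lemma peval_peval: "peval \<rho> (peval \<sigma> f) = peval (\<lambda>v. peval \<rho> (\<sigma> v)) f"
  unfolding peval_def[of \<sigma>] peval_def[of "\<lambda>v. peval \<rho> (\<sigma> v)"]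
  by (simp only: peval_sum peval_mult peval_prod peval_power peval_of_int)

lemma monomial_value_pvar: "monomial_value pvar m = Poly_Mapping.single m 1"
proof -
  have pw: "pvar v ^ n = Poly_Mapping.single (Poly_Mapping.single v n) 1" for v :: "'a + 'a" and n
    by (induction n) (simp_all add: pvar_def mult_single single_add[symmetric])
  have "monomial_value pvar m = (\<Prod>v\<in>A. Poly_Mapping.single (Poly_Mapping.single v (Poly_Mapping.lookup m v)) 1)"
    if "A = Poly_Mapping.keys m" for A
    using that by (simp add: monomial_value_def pw)
  also have "(\<Prod>v\<in>A. Poly_Mapping.single (Poly_Mapping.single v (Poly_Mapping.lookup m v)) (1::int))
      = Poly_Mapping.single (\<Sum>v\<in>A. Poly_Mapping.single v (Poly_Mapping.lookup m v)) 1" for A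
    by (induction A rule: infinite_finite_induct) (simp_all add: mult_single)
  finally show ?thesis using sum_single_lookup[of m] by simp
qed

lemma peval_pvar_self: "peval pvar f = f"
  using sum_single_lookup[of f]
  by (subst peval_superset[of "Poly_Mapping.keys f"])
     (simp_all add: monomial_value_pvar mult_single flip: single_of_int)


lemma prime_dvd_power_add_diff:
  fixes x y :: "'r::comm_ring_1"
  assumes "prime p"
  shows "of_nat p dvd (x + y) ^ p - (x ^ p + y ^ p)"
proof -
  have p: "2 \<le> p" using assms prime_ge_2_nat by blast
  let ?t = "\<lambda>k. of_nat (p choose k) * x ^ k * y ^ (p - k)"
  have split: "{..p} = insert 0 (insert p {0<..<p})" using p by auto
  have "(x + y) ^ p = (\<Sum>k\<le>p. ?t k)" by (rule binomial_ring)
  also have "\<dots> = ?t 0 + (?t p + (\<Sum>k\<in>{0<..<p}. ?t k))"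
    unfolding split using p by (subst sum.insert; simp)+
  finally have "(x + y) ^ p - (x ^ p + y ^ p) = (\<Sum>k\<in>{0<..<p}. ?t k)" by simp
  also have "of_nat p dvd \<dots>"
  proof (rule dvd_sum)
    fix k assume "k \<in> {0<..<p}"
    then have "p dvd p choose k" using assms by (intro dvd_choose_prime) auto
    then have "(of_nat p :: 'r) dvd of_nat (p choose k)" by (metis dvd_def of_nat_mult)
    then show "of_nat p dvd ?t k" by (simp add: dvd_mult2)
  qed
  finally show ?thesis .
qed

text \<open>
  \<open>x\<^sup>p - y\<^sup>p\<close> is \<open>x - y\<close> times a sum of \<open>p\<close> terms that are all congruent to \<open>y\<^sup>p\<^sup>-\<^sup>1\<close> modulo \<open>p\<close>; that sum is therefore
  divisible by \<open>p\<close>.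
\<close>

lemma dvd_power_prime_diff:
  fixes x y :: "'r::comm_ring_1"
  assumes "of_nat p ^ Suc j dvd x - y"
  shows "of_nat p ^ Suc (Suc j) dvd x ^ p - y ^ p"
proof -
  have pxy: "of_nat p dvd x - y"
    using assms dvd_mult_left[of "of_nat p" "of_nat p ^ j" "x - y"] by simp
  have dvd_pow: "of_nat p dvd x ^ i - y ^ i" for i
    using pxy by (metis dvd_mult2 power_diff_sumr2)
  let ?s = "\<Sum>i<p. y ^ (p - Suc i) * x ^ i"
  have "of_nat p dvd (\<Sum>i<p. y ^ (p - Suc i) * x ^ i - y ^ (p - Suc i) * y ^ i)"
    by (intro dvd_sum) (metis dvd_pow dvd_mult right_diff_distrib)
  moreover have "(\<Sum>i<p. y ^ (p - Suc i) * y ^ i) = of_nat p * y ^ (p - 1)"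
  proof -
    have "(\<Sum>i<p. y ^ (p - Suc i) * y ^ i) = (\<Sum>i<p. y ^ (p - 1))"
      by (rule sum.cong) (auto simp flip: power_add)
    then show ?thesis by simp
  qed
  ultimately have "of_nat p dvd ?s - of_nat p * y ^ (p - 1)"
    by (simp add: sum_subtractf)
  then have "of_nat p dvd ?s" by (metis dvd_diff_right_iff dvd_triv_left dvd_add_right_iff diff_add_cancel dvd_add)
  then have "of_nat p ^ Suc j * of_nat p dvd (x - y) * ?s"
    by (rule mult_dvd_mono[OF assms])
  then show ?thesis
    by (simp add: power_diff_sumr2 mult.commute mult.left_commute)
qed

lemma dvd_power_prime_power_diff:
  fixes x y :: "'r::comm_ring_1"
  assumes "of_nat p dvd x - y"
  shows "of_nat p ^ Suc j dvd x ^ p ^ j - y ^ p ^ j"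
proof (induction j)
  case 0
  then show ?case using assms by simp
next
  case (Suc j)
  from dvd_power_prime_diff[OF this] show ?case
    by (simp add: power_mult[symmetric] mult.commute)
qed

text \<open>
  The \<open>n\<close>-th ghost component, which is the Witt polynomial of \<open>\<int>\<^sub>p/p\<^sup>n\<int>\<^sub>p\<close>.
\<close>

definition ghost :: "nat \<Rightarrow> (nat \<Rightarrow> 'r) \<Rightarrow> nat \<Rightarrow> 'r::comm_ring_1" where
  "ghost p x n = (\<Sum>i\<le>n. of_nat (p ^ i) * x i ^ p ^ (n - i))"

text \<open>
  All but the last term of a ghost component form the previous ghost component of the \<open>p\<close>-th powers.
\<close>

lemma ghost_shift:
  "(\<Sum>i\<le>n. of_nat (p ^ i) * (x i ^ p) ^ p ^ (n - i)) = ghost p x (Suc n) - of_nat (p ^ Suc n) * x (Suc n)"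
  unfolding ghost_def
  by (simp add: Suc_diff_le power_mult[symmetric] del: of_nat_power)

lemma ghost_Suc_step:
  "ghost p x (Suc n) = (\<Sum>i\<le>n. of_nat (p ^ i) * (x i ^ p) ^ p ^ (n - i)) + of_nat (p ^ Suc n) * x (Suc n)"
  by (simp only: ghost_shift diff_add_cancel)

lemma ghost_cong: "(\<And>i. i \<le> n \<Longrightarrow> x i = y i) \<Longrightarrow> ghost p x n = ghost p y n"
  by (simp add: ghost_def)

text \<open>
  Ghost components determine the coordinates one after the other, because multiplication by \<open>p\<^sup>n\<close> is injective
  on integral polynomials.
\<close>

lemma ghost_inj:
  fixes x y :: "nat \<Rightarrow> 'i poly2"
  assumes "0 < p" and "\<And>n. ghost p x n = ghost p y n"
  shows "x n = y n"
proof (induction n rule: less_induct)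
  case (less n)
  have "of_nat (p ^ n) * x n = of_nat (p ^ n) * y n"
  proof (cases n)
    case 0
    then show ?thesis using assms(2)[of 0] by (simp add: ghost_def)
  next
    case (Suc m)
    have "(\<Sum>i\<le>m. of_nat (p ^ i) * (x i ^ p) ^ p ^ (m - i)) = (\<Sum>i\<le>m. of_nat (p ^ i) * (y i ^ p) ^ p ^ (m - i))"
      by (rule sum.cong) (simp_all add: less Suc)
    then show ?thesis using assms(2)[of n] by (simp add: Suc ghost_Suc_step)
  qed
  then show ?case by (rule poly2_torsion_free) (simp add: \<open>0 < p\<close>)
qed

definition frob :: "nat \<Rightarrow> 'i poly2 \<Rightarrow> 'i poly2" where
  "frob p = peval (\<lambda>v. pvar v ^ p)"

text \<open>
  Both sides are additive and multiplicative modulo \<open>p\<close> and they agree on variables; every polynomial is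
  built from variables by ring operations.
\<close>

lemma frob_lifts_power:
  assumes "prime p"
  shows "of_nat p dvd frob p f - f ^ p"
proof -
  define C :: "'a poly2 set" where "C = {f. of_nat p dvd frob p f - f ^ p}"
  have p: "0 < p" using assms prime_gt_0_nat by blast
  have zero: "0 \<in> C" using p by (simp add: C_def frob_def peval_0 power_0_left)
  have one: "1 \<in> C" by (simp add: C_def frob_def peval_1)
  have add: "f + g \<in> C" if "f \<in> C" "g \<in> C" for f g
  proof -
    have "of_nat p dvd (frob p f - f ^ p) + (frob p g - g ^ p) - ((f + g) ^ p - (f ^ p + g ^ p))"
      by (rule dvd_diff[OF dvd_add prime_dvd_power_add_diff[OF assms]]) (use that in \<open>simp_all add: C_def\<close>)
    then show ?thesis by (simp add: C_def frob_def peval_add algebra_simps)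
  qed
  have mult: "f * g \<in> C" if "f \<in> C" "g \<in> C" for f g
  proof -
    have "of_nat p dvd (frob p f - f ^ p) * frob p g + f ^ p * (frob p g - g ^ p)"
      using that by (auto simp: C_def)
    then show ?thesis by (simp add: C_def frob_def peval_mult algebra_simps power_mult_distrib)
  qed
  have minus: "- f \<in> C" if "f \<in> C" for f
  proof -
    have 1: "of_nat p dvd (0::'a poly2) ^ p - (f ^ p + (- f) ^ p)"
      using prime_dvd_power_add_diff[OF assms, of f "- f"] by simp
    have 2: "of_nat p dvd - (frob p f - f ^ p)"
      unfolding dvd_minus_iff using that by (simp add: C_def)
    have "of_nat p dvd - (frob p f - f ^ p) + ((0::'a poly2) ^ p - (f ^ p + (- f) ^ p))"
      by (rule dvd_add[OF 2 1])
    moreover have "frob p (- f) = - frob p f"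
      using peval_add[of "\<lambda>v. pvar v ^ p" f "- f"] by (simp add: frob_def peval_0 eq_neg_iff_add_eq_0 add.commute)
    ultimately show ?thesis using p by (simp add: C_def power_0_left)
  qed
  have var: "pvar v \<in> C" for v by (simp add: C_def frob_def peval_pvar)
  have nat: "of_nat n \<in> C" for n by (induction n) (auto intro: zero one add)
  have int: "of_int c \<in> C" for c
    by (cases c) (use nat minus in \<open>simp_all only: of_int_minus of_int_of_nat_eq\<close>)
  have pow: "f ^ n \<in> C" if "f \<in> C" for f n by (induction n) (auto intro: one mult that)
  have prod: "prod g A \<in> C" if "\<And>a. a \<in> A \<Longrightarrow> g a \<in> C" for g :: "'a + 'a \<Rightarrow> _" and A
    using that by (induction A rule: infinite_finite_induct) (auto intro: one mult)
  have sum: "sum g A \<in> C" if "\<And>a. a \<in> A \<Longrightarrow> g a \<in> C" for g :: "('a + 'a \<Rightarrow>\<^sub>0 nat) \<Rightarrow> _" and A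
    using that by (induction A rule: infinite_finite_induct) (auto intro: zero add)
  have "peval pvar f \<in> C"
    unfolding peval_def by (intro sum mult int prod pow var)
  then show ?thesis by (simp add: peval_pvar_self C_def)
qed

lemma frob_ghost: "frob p (ghost p x n) = (\<Sum>i\<le>n. of_nat (p ^ i) * frob p (x i) ^ p ^ (n - i))"
  by (simp add: ghost_def frob_def peval_sum peval_mult peval_power peval_of_nat del: of_nat_power)

text \<open>
  From \<open>\<phi>(x) \<equiv> x\<^sup>p\<close> modulo \<open>p\<close>, raising to the power \<open>p\<^sup>n\<^sup>-\<^sup>i\<close> gives a congruence modulo \<open>p\<^sup>n\<^sup>-\<^sup>i\<^sup>+\<^sup>1\<close>, and the
  factor \<open>p\<^sup>i\<close> makes up the difference.
\<close>

lemma frob_ghost_cong: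
  assumes "prime p"
  shows "of_nat (p ^ Suc n) dvd frob p (ghost p x n) - (\<Sum>i\<le>n. of_nat (p ^ i) * (x i ^ p) ^ p ^ (n - i))"
proof -
  have "of_nat (p ^ Suc n) dvd of_nat (p ^ i) * frob p (x i) ^ p ^ (n - i) - of_nat (p ^ i) * (x i ^ p) ^ p ^ (n - i)"
    if "i \<le> n" for i
  proof -
    have "of_nat p ^ i * of_nat p ^ Suc (n - i) dvd
        of_nat p ^ i * (frob p (x i) ^ p ^ (n - i) - (x i ^ p) ^ p ^ (n - i))"
      by (intro mult_dvd_mono dvd_refl dvd_power_prime_power_diff frob_lifts_power assms)
    then show ?thesis using that by (simp add: power_add[symmetric] algebra_simps)
  qed
  then show ?thesis
    unfolding frob_ghost sum_subtractf[symmetric] by (intro dvd_sum) auto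
qed

text \<open>
  The coordinates are found one at a time.  If the first \<open>n + 1\<close> of them realise \<open>a\<^sub>n\<close>, the part of the next ghost
  component that they determine is congruent to \<open>\<phi>(a\<^sub>n)\<close>, hence to \<open>a\<^sub>n\<^sub>+\<^sub>1\<close>, modulo \<open>p\<^sup>n\<^sup>+\<^sup>1\<close>, and the next
  coordinate enters with exactly this factor.
\<close>

lemma dwork:
  fixes a :: "nat \<Rightarrow> 'i poly2"
  assumes "prime p" and a: "\<And>n. of_nat (p ^ Suc n) dvd a (Suc n) - frob p (a n)"
  obtains s where "\<And>n. ghost p s n = a n"
proof -
  have ex: "\<exists>c. (\<Sum>i\<le>n. of_nat (p ^ i) * (x i ^ p) ^ p ^ (n - i)) + of_nat (p ^ Suc n) * c = a (Suc n)"
    if "ghost p x n = a n" for x n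
  proof -
    have "of_nat (p ^ Suc n) dvd (a (Suc n) - frob p (a n)) +
        (frob p (ghost p x n) - (\<Sum>i\<le>n. of_nat (p ^ i) * (x i ^ p) ^ p ^ (n - i)))"
      by (rule dvd_add[OF a frob_ghost_cong[OF assms(1)]])
    then obtain c where "(a (Suc n) - frob p (a n)) +
        (frob p (ghost p x n) - (\<Sum>i\<le>n. of_nat (p ^ i) * (x i ^ p) ^ p ^ (n - i))) = of_nat (p ^ Suc n) * c"
      by (rule dvdE)
    then have "a (Suc n) - (\<Sum>i\<le>n. of_nat (p ^ i) * (x i ^ p) ^ p ^ (n - i)) = of_nat (p ^ Suc n) * c"
      by (simp only: that) simp
    then show ?thesis
      unfolding diff_eq_eq by (intro exI[of _ c]) (simp only: add.commute)
  qed
  \<comment> \<open>Stage \<open>n\<close> is a sequence of which only the entries up to \<open>n\<close> matter; the diagonal is the solution.\<close>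
  have "\<exists>f. \<forall>n. (ghost p (f n) n = a n) \<and> (\<forall>i\<le>n. f (Suc n) i = f n i)"
  proof (rule dependent_nat_choice)
    show "\<exists>x. ghost p x 0 = a 0" by (rule exI[of _ "\<lambda>_. a 0"]) (simp add: ghost_def)
  next
    fix x n assume "ghost p x n = a n"
    from ex[OF this] obtain c where
      c: "(\<Sum>i\<le>n. of_nat (p ^ i) * (x i ^ p) ^ p ^ (n - i)) + of_nat (p ^ Suc n) * c = a (Suc n)" by blast
    have "ghost p (x(Suc n := c)) (Suc n) = a (Suc n)"
      unfolding ghost_Suc_step by (simp add: c[symmetric])
    then show "\<exists>y. ghost p y (Suc n) = a (Suc n) \<and> (\<forall>i\<le>n. y i = x i)"
      by (intro exI[of _ "x(Suc n := c)"]) auto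
  qed
  then obtain f where f: "\<And>n. ghost p (f n) n = a n" "\<And>n i. i \<le> n \<Longrightarrow> f (Suc n) i = f n i" by blast
  have stable: "f n i = f i i" if "i \<le> n" for i n
    using that by (induction rule: dec_induct) (simp_all add: f(2))
  have "ghost p (\<lambda>i. f i i) n = a n" for n
    by (subst f(1)[symmetric]) (rule ghost_cong, erule stable[symmetric])
  then show thesis by (rule that)
qed

text \<open>
  Ghost components of families of variables satisfy Dwork's congruences.  These are stable under sums
  and products, which is why addition and multiplication of Witt vectors are integral.
\<close>

lemma frob_ghost_pvar:
  "of_nat (p ^ Suc n) dvd ghost p (\<lambda>i. pvar (v i)) (Suc n) - frob p (ghost p (\<lambda>i. pvar (v i)) n)"
proof -
  have "frob p (pvar w) = pvar w ^ p" for w :: "'a + 'a" by (simp add: frob_def peval_pvar)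
  then show ?thesis unfolding frob_ghost by (simp only: ghost_shift) simp
qed


section \<open>$p$-typical Witt vectors\<close>

text \<open>
  The isomorphism class of \<open>\<int>\<^sub>p/p\<^sup>n\<int>\<^sub>p\<close>, at which the \<open>n\<close>-th coordinate of a Witt vector sits.
\<close>

definition level :: "nat \<Rightarrow> nat \<Rightarrow> padic set set" where
  "level p n = {pn_Zp p n}"

lemma gset_class_pn_Zp:
  assumes "prime p"
  shows "gset_class (Zp p) (Zp_topology p) (pn_Zp p n) = level p n"
proof -
  interpret comm_group "Zp p" using Zp_comm_group[OF prime_gt_0_nat[OF assms]] .
  show ?thesis
    unfolding level_def by (rule gset_class_eq) (simp add: open_subgroups_Zp[OF assms])
qed

lemma gsets_Zp:
  assumes "prime p"
  shows "gsets (Zp p) (Zp_topology p) = range (level p)"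
proof -
  interpret comm_group "Zp p" using Zp_comm_group[OF prime_gt_0_nat[OF assms]] .
  show ?thesis
    unfolding gsets_eq open_subgroups_Zp[OF assms] level_def by (simp add: image_image)
qed

lemma witt_coord_level: "prime p \<Longrightarrow> witt_coord p w n = w (level p n)"
  unfolding witt_coord_def pn_Zp_def[symmetric] by (simp add: gset_class_pn_Zp)

lemma level_inj:
  assumes "prime p"
  shows "inj (level p)"
proof (rule injI)
  fix m n assume "level p m = level p n"
  then have "pn_Zp p m = pn_Zp p n" by (simp add: level_def)
  then show "m = n"
    using pn_Zp_subset_iff[OF prime_gt_1_nat[OF assms], of m n]
      pn_Zp_subset_iff[OF prime_gt_1_nat[OF assms], of n m] by simp
qed

lemma witt_poly_Zp:
  assumes p: "prime p"
  shows "witt_poly (Zp p) (Zp_topology p) (level p n) x = ghost p (\<lambda>i. x (level p i)) n"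
proof -
  have p0: "0 < p" and p1: "1 < p" using prime_gt_0_nat[OF p] prime_gt_1_nat[OF p] by auto
  interpret comm_group "Zp p" using Zp_comm_group[OF p0] .
  note sub = pn_Zp_subgroup[OF p0]
  have le: "gset_le (Zp p) (level p i) (level p n) \<longleftrightarrow> i \<le> n" for i
    by (simp add: gset_le_def level_def gmaps_nonempty_iff[OF sub sub] pn_Zp_subset_iff[OF p1])
  have size: "gset_size (Zp p) (level p i) = p ^ i" for i
    by (simp add: gset_size_def level_def card_lcosets_pn_Zp[OF p0])
  have num: "num_gmaps (Zp p) (level p n) (level p i) = p ^ i" if "i \<le> n" for i
  proof -
    have "pn_Zp p n \<subseteq> pn_Zp p i" using that by (simp add: pn_Zp_subset_iff[OF p1])
    from bij_betw_same_card[OF bij_betw_gmaps[OF sub sub this]] show ?thesis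
      by (simp add: num_gmaps_def level_def card_lcosets_pn_Zp[OF p0])
  qed
  have "{U \<in> gsets (Zp p) (Zp_topology p). gset_le (Zp p) U (level p n)} = level p ` {..n}"
    by (auto simp: gsets_Zp[OF p] le)
  then have "witt_poly (Zp p) (Zp_topology p) (level p n) x =
      (\<Sum>i\<le>n. of_nat (num_gmaps (Zp p) (level p n) (level p i)) *
        x (level p i) ^ (gset_size (Zp p) (level p n) div gset_size (Zp p) (level p i)))"
    by (simp add: witt_poly_def sum.reindex inj_on_subset[OF level_inj[OF p]])
  also have "\<dots> = ghost p (\<lambda>i. x (level p i)) n"
    unfolding ghost_def
    by (rule sum.cong) (use p0 in \<open>simp_all add: num size power_diff[symmetric] del: of_nat_power\<close>)
  finally show ?thesis .
qed

text \<open>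
  The two description operators that define the sum and product polynomials are legitimate: Dwork's
  lemma gives existence, and injectivity of the ghost map gives uniqueness.
\<close>

lemma witt_family_ex1:
  fixes a :: "padic set set \<Rightarrow> 'i poly2"
  assumes p: "prime p"
    and a: "\<And>n. of_nat (p ^ Suc n) dvd a (level p (Suc n)) - frob p (a (level p n))"
  shows "\<exists>!S. S \<in> extensional (gsets (Zp p) (Zp_topology p)) \<and>
     (\<forall>T\<in>gsets (Zp p) (Zp_topology p). a T = witt_poly (Zp p) (Zp_topology p) T S)"
proof -
  obtain s where s: "\<And>n. ghost p s n = a (level p n)"
    using dwork[OF p, of "\<lambda>n. a (level p n)"] a by blast
  define S where "S = (\<lambda>T\<in>gsets (Zp p) (Zp_topology p). s (inv_into UNIV (level p) T))"
  have S: "S (level p n) = s n" for n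
    by (simp add: S_def gsets_Zp[OF p] inv_f_f[OF level_inj[OF p]])
  show ?thesis
  proof (rule ex1I[of _ S])
    show "S \<in> extensional (gsets (Zp p) (Zp_topology p)) \<and>
       (\<forall>T\<in>gsets (Zp p) (Zp_topology p). a T = witt_poly (Zp p) (Zp_topology p) T S)"
    proof
      show "S \<in> extensional (gsets (Zp p) (Zp_topology p))" unfolding S_def by (rule restrict_extensional)
      show "\<forall>T\<in>gsets (Zp p) (Zp_topology p). a T = witt_poly (Zp p) (Zp_topology p) T S"
        unfolding gsets_Zp[OF p] by (auto simp: witt_poly_Zp[OF p] S s)
    qed
  next
    fix S' assume S': "S' \<in> extensional (gsets (Zp p) (Zp_topology p)) \<and>
       (\<forall>T\<in>gsets (Zp p) (Zp_topology p). a T = witt_poly (Zp p) (Zp_topology p) T S')"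
    then have "ghost p (\<lambda>i. S' (level p i)) n = ghost p s n" for n
      by (simp add: gsets_Zp[OF p] witt_poly_Zp[OF p] s)
    then have eq: "S' (level p n) = S (level p n)" for n
      using ghost_inj[OF prime_gt_0_nat[OF p], of "\<lambda>i. S' (level p i)" s] by (simp add: S)
    show "S' = S"
    proof (rule extensionalityI)
      show "S' \<in> extensional (gsets (Zp p) (Zp_topology p))" using S' by blast
      show "S \<in> extensional (gsets (Zp p) (Zp_topology p))" unfolding S_def by (rule restrict_extensional)
      show "S' T = S T" if "T \<in> gsets (Zp p) (Zp_topology p)" for T
        using that eq by (auto simp: gsets_Zp[OF p])
    qed
  qed
qed

lemma witt_sum_polys_ghost:
  assumes p: "prime p"
  shows "ghost p (\<lambda>i. witt_sum_polys (Zp p) (Zp_topology p) (level p i)) n =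
    ghost p (\<lambda>i. pvar (Inl (level p i))) n + ghost p (\<lambda>i. pvar (Inr (level p i))) n"
proof -
  let ?a = "\<lambda>T. witt_poly (Zp p) (Zp_topology p) T (\<lambda>U. pvar (Inl U)) +
    witt_poly (Zp p) (Zp_topology p) T (\<lambda>U. pvar (Inr U))"
  let ?X = "\<lambda>n. ghost p (\<lambda>i. pvar (Inl (level p i))) n" and ?Y = "\<lambda>n. ghost p (\<lambda>i. pvar (Inr (level p i))) n"
  have "of_nat (p ^ Suc n) dvd ?a (level p (Suc n)) - frob p (?a (level p n))" for n
  proof -
    have "of_nat (p ^ Suc n) dvd (?X (Suc n) - frob p (?X n)) + (?Y (Suc n) - frob p (?Y n))"
      by (intro dvd_add frob_ghost_pvar)
    then show ?thesis by (simp add: witt_poly_Zp[OF p] frob_def peval_add algebra_simps)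
  qed
  from theI'[OF witt_family_ex1[OF p this], folded witt_sum_polys_def]
  have "?a (level p n) = witt_poly (Zp p) (Zp_topology p) (level p n) (witt_sum_polys (Zp p) (Zp_topology p))"
    by (simp add: gsets_Zp[OF p])
  then show ?thesis by (simp add: witt_poly_Zp[OF p])
qed

lemma witt_prod_polys_ghost:
  assumes p: "prime p"
  shows "ghost p (\<lambda>i. witt_prod_polys (Zp p) (Zp_topology p) (level p i)) n =
    ghost p (\<lambda>i. pvar (Inl (level p i))) n * ghost p (\<lambda>i. pvar (Inr (level p i))) n"
proof -
  let ?a = "\<lambda>T. witt_poly (Zp p) (Zp_topology p) T (\<lambda>U. pvar (Inl U)) *
    witt_poly (Zp p) (Zp_topology p) T (\<lambda>U. pvar (Inr U))"
  let ?X = "\<lambda>n. ghost p (\<lambda>i. pvar (Inl (level p i))) n" and ?Y = "\<lambda>n. ghost p (\<lambda>i. pvar (Inr (level p i))) n"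
  have "of_nat (p ^ Suc n) dvd ?a (level p (Suc n)) - frob p (?a (level p n))" for n
  proof -
    have "of_nat (p ^ Suc n) dvd (?X (Suc n) - frob p (?X n)) * ?Y (Suc n) + frob p (?X n) * (?Y (Suc n) - frob p (?Y n))"
      by (intro dvd_add dvd_mult dvd_mult2 frob_ghost_pvar)
    then show ?thesis by (simp add: witt_poly_Zp[OF p] frob_def peval_mult algebra_simps)
  qed
  from theI'[OF witt_family_ex1[OF p this], folded witt_prod_polys_def]
  have "?a (level p n) = witt_poly (Zp p) (Zp_topology p) (level p n) (witt_prod_polys (Zp p) (Zp_topology p))"
    by (simp add: gsets_Zp[OF p])
  then show ?thesis by (simp add: witt_poly_Zp[OF p])
qed

lemma peval_ghost: "peval \<sigma> (ghost p s n) = ghost p (\<lambda>i. peval \<sigma> (s i)) n"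
  by (simp add: ghost_def peval_sum peval_mult peval_power peval_of_nat del: of_nat_power)

text \<open>
  To evaluate a sum polynomial at \<open>\<rho>\<close>, first substitute polynomials \<open>\<sigma>\<close> that have the values \<open>\<rho>\<close>.  If the ghost
  components of the substituted families add up to those of a family \<open>t\<close>, the result of the
  substitution is \<open>t\<close>.  The detour is needed because the ghost map need not be injective over the ring in which \<open>\<rho>\<close> takes its
  values; in characteristic \<open>p\<close> it is not.
\<close>

lemma peval_witt_sum_polys:
  fixes \<rho> :: "padic set set + padic set set \<Rightarrow> 'k::comm_ring_1"
    and \<sigma> :: "padic set set + padic set set \<Rightarrow> padic set set poly2"
  assumes p: "prime p" and \<sigma>: "\<And>v. peval \<rho> (\<sigma> v) = \<rho> v"
    and t: "\<And>n. ghost p (\<lambda>i. \<sigma> (Inl (level p i))) n + ghost p (\<lambda>i. \<sigma> (Inr (level p i))) n = ghost p t n"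
  shows "peval \<rho> (witt_sum_polys (Zp p) (Zp_topology p) (level p n)) = peval \<rho> (t n)"
proof -
  let ?S = "\<lambda>i. witt_sum_polys (Zp p) (Zp_topology p) (level p i)"
  have "ghost p (\<lambda>i. peval \<sigma> (?S i)) n = ghost p t n" for n
    unfolding peval_ghost[symmetric] witt_sum_polys_ghost[OF p] peval_add
    by (simp only: peval_ghost peval_pvar t)
  then have "peval \<sigma> (?S n) = t n" by (rule ghost_inj[OF prime_gt_0_nat[OF p]])
  then have "peval \<rho> (peval \<sigma> (?S n)) = peval \<rho> (t n)" by simp
  then show ?thesis by (simp add: peval_peval \<sigma>)
qed

lemma peval_witt_prod_polys:
  fixes \<rho> :: "padic set set + padic set set \<Rightarrow> 'k::comm_ring_1"
    and \<sigma> :: "padic set set + padic set set \<Rightarrow> padic set set poly2"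
  assumes p: "prime p" and \<sigma>: "\<And>v. peval \<rho> (\<sigma> v) = \<rho> v"
    and t: "\<And>n. ghost p (\<lambda>i. \<sigma> (Inl (level p i))) n * ghost p (\<lambda>i. \<sigma> (Inr (level p i))) n = ghost p t n"
  shows "peval \<rho> (witt_prod_polys (Zp p) (Zp_topology p) (level p n)) = peval \<rho> (t n)"
proof -
  let ?M = "\<lambda>i. witt_prod_polys (Zp p) (Zp_topology p) (level p i)"
  have "ghost p (\<lambda>i. peval \<sigma> (?M i)) n = ghost p t n" for n
    unfolding peval_ghost[symmetric] witt_prod_polys_ghost[OF p] peval_mult
    by (simp only: peval_ghost peval_pvar t)
  then have "peval \<sigma> (?M n) = t n" by (rule ghost_inj[OF prime_gt_0_nat[OF p]])
  then have "peval \<rho> (peval \<sigma> (?M n)) = peval \<rho> (t n)" by simp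
  then show ?thesis by (simp add: peval_peval \<sigma>)
qed

lemma ghost_zero: "0 < p \<Longrightarrow> ghost p (\<lambda>i. 0) n = 0"
  by (simp add: ghost_def power_0_left)

lemma ghost_one:
  assumes "0 < p"
  shows "ghost p (\<lambda>i. if i = 0 then 1 else 0) n = (1 :: 'r::comm_ring_1)"
proof -
  have "ghost p (\<lambda>i. if i = 0 then 1 else 0) n = (\<Sum>i\<le>n. if i = 0 then 1 else 0 :: 'r)"
    unfolding ghost_def by (rule sum.cong) (use assms in \<open>auto simp: power_0_left\<close>)
  then show ?thesis by simp
qed

lemma carrier_Wp: "prime p \<Longrightarrow> carrier (Wp p) = range (level p) \<rightarrow>\<^sub>E UNIV"
  by (simp add: Wp_def witt_burnside_def gsets_Zp)

lemma Wp_eqI: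
  assumes "prime p" "a \<in> carrier (Wp p)" "b \<in> carrier (Wp p)" "\<And>n. a (level p n) = b (level p n)"
  shows "a = b"
  using assms(2,3) unfolding carrier_Wp[OF assms(1)]
  by (rule PiE_ext) (auto simp: assms(4))

lemma Wp_zero:
  assumes "prime p"
  shows "\<zero>\<^bsub>Wp p\<^esub> \<in> carrier (Wp p)" "\<zero>\<^bsub>Wp p\<^esub> (level p n) = 0"
  by (simp_all add: Wp_def witt_burnside_def gsets_Zp[OF assms])

lemma pn_Zp_0: "pn_Zp p 0 = carrier (Zp p)"
proof -
  have "x 0 = 0" if "x \<in> carrier (Zp p)" for x
    using that spec[of "\<lambda>n. x n \<in> {0..<int p ^ n} \<and> x (Suc n) mod int p ^ n = x n" 0]
    by (simp add: carrier_Zp)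
  then show ?thesis by (auto simp: pn_Zp_def)
qed

lemma Wp_one:
  assumes p: "prime p"
  shows "\<one>\<^bsub>Wp p\<^esub> \<in> carrier (Wp p)" "\<one>\<^bsub>Wp p\<^esub> (level p n) = (if n = 0 then 1 else 0)"
  using gset_class_pn_Zp[OF p, of 0] level_inj[OF p]
  by (auto simp: Wp_def witt_burnside_def teichmueller_def gsets_Zp[OF p] pn_Zp_0 inj_eq)

lemma Wp_add:
  assumes "prime p"
  shows "a \<oplus>\<^bsub>Wp p\<^esub> b \<in> carrier (Wp p)"
    "(a \<oplus>\<^bsub>Wp p\<^esub> b) (level p n) = peval (case_sum a b) (witt_sum_polys (Zp p) (Zp_topology p) (level p n))"
  by (simp_all add: Wp_def witt_burnside_def gsets_Zp[OF assms])

lemma Wp_mult: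
  assumes "prime p"
  shows "a \<otimes>\<^bsub>Wp p\<^esub> b \<in> carrier (Wp p)"
    "(a \<otimes>\<^bsub>Wp p\<^esub> b) (level p n) = peval (case_sum a b) (witt_prod_polys (Zp p) (Zp_topology p) (level p n))"
  by (simp_all add: Wp_def witt_burnside_def gsets_Zp[OF assms])

text \<open>
  Elements of \<open>\<^bold>W(k)\<close> are functions on a whole type, with an unspecified value outside the isomorphism
  classes.  A substitution that is meant to have such an element as its values must specialise only
  the variables at isomorphism classes and keep the other ones.
\<close>

definition override_levels :: "nat \<Rightarrow> (nat \<Rightarrow> 'r) \<Rightarrow> (padic set set \<Rightarrow> 'r) \<Rightarrow> padic set set \<Rightarrow> 'r" where
  "override_levels p c x U = (if U \<in> range (level p) then c (inv_into UNIV (level p) U) else x U)"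

lemma override_levels_level: "prime p \<Longrightarrow> override_levels p c x (level p n) = c n"
  by (simp add: override_levels_def inv_f_f[OF level_inj])

lemma peval_override_levels:
  assumes "prime p" and "\<And>n. peval \<rho> (c n) = b (level p n)" and "\<And>U. peval \<rho> (x U) = b U"
  shows "peval \<rho> (override_levels p c x U) = b U"
  using assms(2,3) by (auto simp: override_levels_def inv_f_f[OF level_inj[OF assms(1)]])

lemma Wp_add_zero:
  assumes p: "prime p" and a: "a \<in> carrier (Wp p)"
  shows "a \<oplus>\<^bsub>Wp p\<^esub> \<zero>\<^bsub>Wp p\<^esub> = a" "\<zero>\<^bsub>Wp p\<^esub> \<oplus>\<^bsub>Wp p\<^esub> a = a"
proof -
  have p0: "0 < p" using prime_gt_0_nat[OF p] .
  note zero = ghost_zero[OF p0]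
  let ?z = "\<zero>\<^bsub>Wp p\<^esub> :: 'a witt"
  let ?\<sigma> = "case_sum (\<lambda>U. pvar (Inl U)) (override_levels p (\<lambda>_. 0) (\<lambda>U. pvar (Inr U)))"
  have "peval (case_sum a ?z) (?\<sigma> v) = case_sum a ?z v" for v
    by (cases v) (simp_all add: peval_pvar peval_override_levels[OF p] peval_0 Wp_zero[OF p])
  from peval_witt_sum_polys[OF p this, of "\<lambda>n. pvar (Inl (level p n))"]
  show "a \<oplus>\<^bsub>Wp p\<^esub> ?z = a"
    by (intro Wp_eqI[OF p Wp_add(1)[OF p] a])
      (simp add: Wp_add(2)[OF p] override_levels_level[OF p] zero peval_pvar)
  let ?\<tau> = "case_sum (override_levels p (\<lambda>_. 0) (\<lambda>U. pvar (Inl U))) (\<lambda>U. pvar (Inr U))"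
  have "peval (case_sum ?z a) (?\<tau> v) = case_sum ?z a v" for v
    by (cases v) (simp_all add: peval_pvar peval_override_levels[OF p] peval_0 Wp_zero[OF p])
  from peval_witt_sum_polys[OF p this, of "\<lambda>n. pvar (Inr (level p n))"]
  show "?z \<oplus>\<^bsub>Wp p\<^esub> a = a"
    by (intro Wp_eqI[OF p Wp_add(1)[OF p] a])
      (simp add: Wp_add(2)[OF p] override_levels_level[OF p] zero peval_pvar)
qed

lemma Wp_mult_zero:
  assumes p: "prime p"
  shows "a \<otimes>\<^bsub>Wp p\<^esub> \<zero>\<^bsub>Wp p\<^esub> = \<zero>\<^bsub>Wp p\<^esub>"
proof -
  have p0: "0 < p" using prime_gt_0_nat[OF p] .
  let ?z = "\<zero>\<^bsub>Wp p\<^esub> :: 'a witt"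
  let ?\<sigma> = "case_sum (\<lambda>U. pvar (Inl U)) (override_levels p (\<lambda>_. 0) (\<lambda>U. pvar (Inr U)))"
  have "peval (case_sum a ?z) (?\<sigma> v) = case_sum a ?z v" for v
    by (cases v) (simp_all add: peval_pvar peval_override_levels[OF p] peval_0 Wp_zero[OF p])
  from peval_witt_prod_polys[OF p this, of "\<lambda>n. 0"]
  show ?thesis
    by (intro Wp_eqI[OF p Wp_mult(1)[OF p] Wp_zero(1)[OF p]])
      (simp add: Wp_mult(2)[OF p] override_levels_level[OF p] ghost_zero[OF p0] peval_0 Wp_zero(2)[OF p])
qed

lemma Wp_mult_one:
  assumes p: "prime p" and a: "a \<in> carrier (Wp p)"
  shows "a \<otimes>\<^bsub>Wp p\<^esub> \<one>\<^bsub>Wp p\<^esub> = a"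
proof -
  have p0: "0 < p" using prime_gt_0_nat[OF p] .
  let ?e = "\<one>\<^bsub>Wp p\<^esub> :: 'a witt"
  let ?\<sigma> = "case_sum (\<lambda>U. pvar (Inl U))
    (override_levels p (\<lambda>n. if n = 0 then 1 else 0) (\<lambda>U. pvar (Inr U)))"
  have "peval (case_sum a ?e) (?\<sigma> v) = case_sum a ?e v" for v
    by (cases v) (simp_all add: peval_pvar peval_override_levels[OF p] peval_0 peval_1 Wp_one[OF p])
  from peval_witt_prod_polys[OF p this, of "\<lambda>n. pvar (Inl (level p n))"]
  show ?thesis
    by (intro Wp_eqI[OF p Wp_mult(1)[OF p] a])
      (simp add: Wp_mult(2)[OF p] override_levels_level[OF p] ghost_one[OF p0] peval_pvar)
qed

text \<open>
  The negative of \<open>0\<close> is defined by a description; it is \<open>0\<close> because \<open>0\<close> is neutral on both sides.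
\<close>

lemma Wp_minus_zero:
  assumes p: "prime p" and a: "a \<in> carrier (Wp p)"
  shows "a \<ominus>\<^bsub>Wp p\<^esub> \<zero>\<^bsub>Wp p\<^esub> = a"
proof -
  have "\<ominus>\<^bsub>Wp p\<^esub> (\<zero>\<^bsub>Wp p\<^esub> :: 'a witt) = \<zero>\<^bsub>Wp p\<^esub>"
    unfolding a_inv_def m_inv_def
  proof (rule the_equality)
    show "\<zero>\<^bsub>Wp p\<^esub> \<in> carrier (add_monoid (Wp p :: 'a witt ring)) \<and>
      \<zero>\<^bsub>Wp p\<^esub> \<otimes>\<^bsub>add_monoid (Wp p)\<^esub> \<zero>\<^bsub>Wp p\<^esub> = \<one>\<^bsub>add_monoid (Wp p :: 'a witt ring)\<^esub> \<and>
      \<zero>\<^bsub>Wp p\<^esub> \<otimes>\<^bsub>add_monoid (Wp p)\<^esub> \<zero>\<^bsub>Wp p\<^esub> = \<one>\<^bsub>add_monoid (Wp p :: 'a witt ring)\<^esub>"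
      using Wp_add_zero[OF p Wp_zero(1)[OF p]] Wp_zero(1)[OF p] by simp
  next
    fix y :: "'a witt"
    assume y: "y \<in> carrier (add_monoid (Wp p)) \<and>
      \<zero>\<^bsub>Wp p\<^esub> \<otimes>\<^bsub>add_monoid (Wp p)\<^esub> y = \<one>\<^bsub>add_monoid (Wp p)\<^esub> \<and>
      y \<otimes>\<^bsub>add_monoid (Wp p)\<^esub> \<zero>\<^bsub>Wp p\<^esub> = \<one>\<^bsub>add_monoid (Wp p)\<^esub>"
    then have "y = \<zero>\<^bsub>Wp p\<^esub> \<oplus>\<^bsub>Wp p\<^esub> y" using Wp_add_zero(2)[OF p, of y] by simp
    then show "y = \<zero>\<^bsub>Wp p\<^esub>" using y by simp
  qed
  then show ?thesis by (simp add: a_minus_def Wp_add_zero(1)[OF p a])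
qed

lemma witt_norm_single:
  assumes p: "prime p" and c: "c \<in> carrier (Wp p)" and coord: "\<And>i. witt_coord p c i = (if i = n then a else 0)"
    and "a \<noteq> 0"
  shows "witt_norm p c = (1 / real p) ^ n"
proof -
  have "witt_coord p \<zero>\<^bsub>Wp p\<^esub> n = (0 :: 'a)" by (simp add: witt_coord_level[OF p] Wp_zero(2)[OF p])
  then have "c \<noteq> \<zero>\<^bsub>Wp p\<^esub>" using coord[of n] \<open>a \<noteq> 0\<close> by auto
  moreover have "(LEAST i. witt_coord p c i \<noteq> 0) = n"
    by (rule Least_equality) (auto simp: coord \<open>a \<noteq> 0\<close> split: if_splits)
  ultimately show ?thesis by (simp add: witt_norm_def)
qed


section \<open>Teichmueller elements and scaled indicators of balls\<close>

theorem theorem6p7: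
  fixes p :: nat
    and \<Phi> :: "(vertex \<Rightarrow> 'k::field) set \<Rightarrow> 'k P1_fun"
  assumes "prime p"
    and "CHAR('k) = p"
    and "\<Phi> \<in> ring_iso (R_ring p) (Lip_ring p (1 / real p))"
    and "\<And>a x n. a \<in> carrier (Wp2 p) \<Longrightarrow> x \<in> P1 p \<Longrightarrow>
           witt_coord p (\<Phi> (R_class p a) x) n = a (x n)"
  shows "\<Phi> ` teichmueller_basis p \<subseteq> scaled_van_der_put p"
proof
  note p = \<open>prime p\<close>
  have p0: "0 < real p" using prime_gt_0_nat[OF p] by simp
  fix f assume "f \<in> \<Phi> ` teichmueller_basis p"
  then obtain T and a :: 'k where T: "T \<in> tree p" and a: "a \<noteq> 0"
    and f: "f = \<Phi> (R_class p (teichmueller (Zp2 p) (Zp2_topology p) T a))"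
    by (auto simp: teichmueller_basis_def)
  let ?\<omega> = "teichmueller (Zp2 p) (Zp2_topology p) T a"
  have \<omega>: "?\<omega> \<in> carrier (Wp2 p)"
    by (simp add: Wp2_def witt_burnside_def teichmueller_def)
  then have R: "R_class p ?\<omega> \<in> carrier (R_ring p)"
    by (auto simp: R_class_def R_ring_def FactRing_def A_RCOSETS_def')
  have "\<Phi> \<in> ring_hom (R_ring p) (Lip_ring p (1 / real p))"
    using assms(3) by (simp add: ring_iso_def)
  then have "f \<in> carrier (Lip_ring p (1 / real p))"
    unfolding f using R by (rule ring_hom_closed)
  then have fE: "f \<in> P1 p \<rightarrow>\<^sub>E carrier (Wp p)" and lip: "lipschitz_with p (1 / real p) f"
    by (auto simp: Lip_ring_def)
  \<comment> \<open>Sizes along a path are \<open>1, p, p\<^sup>2, \<dots>\<close>, so \<open>T\<close> is visited at time \<open>n\<close> or never.\<close>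
  obtain n where n: "gset_size (Zp2 p) T = p ^ n" using gset_size_tree[OF p T] .
  have at_n: "i = n" if x: "x \<in> P1 p" and "x i = T" for x i
  proof -
    have "p ^ i = p ^ n" using P1_size[OF p x, of i] that n by simp
    then show ?thesis by (simp only: power_inject_exp[OF prime_gt_1_nat[OF p]])
  qed
  have coord: "f x (level p i) = (if x i = T then a else 0)" if x: "x \<in> P1 p" for x i
  proof -
    have "x i \<in> gsets (Zp2 p) (Zp2_topology p)" using P1_tree[OF p x, of i] by (simp add: tree_def)
    then have "?\<omega> (x i) = (if x i = T then a else 0)" by (simp add: teichmueller_def)
    then show ?thesis
      using assms(4)[OF \<omega> x, of i] unfolding f[symmetric] witt_coord_level[OF p] by (rule trans[rotated])
  qed
  define c :: "'k witt" where "c = (\<lambda>U\<in>range (level p). if U = level p n then a else 0)"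
  have c: "c \<in> carrier (Wp p)" by (simp add: c_def carrier_Wp[OF p])
  have c_level: "c (level p i) = (if i = n then a else 0)" for i
    using inj_eq[OF level_inj[OF p]] by (simp add: c_def)
  have norm_c: "witt_norm p c = (1 / real p) ^ n"
    by (rule witt_norm_single[OF p c _ a]) (simp add: witt_coord_level[OF p] c_level)
  define D where "D = {x \<in> P1 p. x n = T}"
  have fD: "f x = (if x \<in> D then c else \<zero>\<^bsub>Wp p\<^esub>)" if x: "x \<in> P1 p" for x
  proof (rule Wp_eqI[OF p])
    show "f x \<in> carrier (Wp p)" using fE x by auto
    show "(if x \<in> D then c else \<zero>\<^bsub>Wp p\<^esub>) \<in> carrier (Wp p)" using c by (simp add: Wp_zero(1)[OF p])
    show "f x (level p i) = (if x \<in> D then c else \<zero>\<^bsub>Wp p\<^esub>) (level p i)" for i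
    proof -
      have "x i = T \<longleftrightarrow> x \<in> D \<and> i = n" using at_n[OF x, of i] x unfolding D_def by blast
      then show ?thesis by (simp add: coord[OF x] c_level Wp_zero(2)[OF p])
    qed
  qed
  let ?e = "P1_indicator p D :: 'k P1_fun"
  have "D \<in> P1_balls p" unfolding D_def by (rule paths_through_vertex_ball[OF p T n])
  then have e: "?e \<in> van_der_put_basis p" by (auto simp: van_der_put_basis_def)
  have scaled: "f = (\<lambda>x\<in>P1 p. c \<otimes>\<^bsub>Wp p\<^esub> ?e x)"
  proof (rule extensionalityI[of _ "P1 p"])
    show "f x = (\<lambda>x\<in>P1 p. c \<otimes>\<^bsub>Wp p\<^esub> ?e x) x" if "x \<in> P1 p" for x
      using that by (simp add: fD P1_indicator_def Wp_mult_one[OF p c] Wp_mult_zero[OF p])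
  qed (use fE in \<open>auto simp: PiE_def\<close>)
  \<comment> \<open>The indicator of the whole boundary occurs exactly when \<open>T\<close> is the root.\<close>
  have "if ?e = P1_indicator p (P1 p) then witt_norm p c = 1 else lip_const p f = 1 / real p"
  proof (cases n)
    case 0
    then have "T = tree_root p" using gset_size_1_imp_root[OF p T] n by simp
    then have "D = P1 p" using 0 by (auto simp: D_def P1_def)
    then show ?thesis using norm_c 0 by simp
  next
    case (Suc m)
    obtain x where x: "x \<in> P1 p" "x n = T" using path_through[OF p T n] .
    obtain y where y: "y \<in> P1 p" "y m = x m" "y (Suc m) \<noteq> x (Suc m)"
      using path_leaving_before[OF p x(1)] .
    have xD: "x \<in> D" and yD: "y \<notin> D" using x y Suc by (auto simp: D_def)
    have "\<one>\<^bsub>Wp p\<^esub> \<noteq> (\<zero>\<^bsub>Wp p\<^esub> :: 'k witt)"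
      using Wp_one(2)[OF p, of 0] Wp_zero(2)[OF p, of 0] by (metis zero_neq_one)
    then have "?e y \<noteq> P1_indicator p (P1 p) y" using y(1) yD by (simp add: P1_indicator_def)
    then have ne: "?e \<noteq> P1_indicator p (P1 p)" by metis
    have dist: "P1_dist p x y = (1 / real p) ^ m"
      by (rule P1_dist_first_difference[OF p x(1) y(1)]) (use y in auto)
    have diff: "witt_norm p (f x \<ominus>\<^bsub>Wp p\<^esub> f y) = (1 / real p) ^ Suc m"
      using xD yD norm_c Suc by (simp add: fD x y Wp_minus_zero[OF p c])
    have "lip_const p f = 1 / real p"
      unfolding lip_const_def
    proof (rule cInf_eq_minimum)
      show "1 / real p \<in> {\<alpha>. 0 < \<alpha> \<and> lipschitz_with p \<alpha> f}" using lip p0 by simp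
    next
      fix \<alpha> assume "\<alpha> \<in> {\<alpha>. 0 < \<alpha> \<and> lipschitz_with p \<alpha> f}"
      then have "(1 / real p) ^ Suc m \<le> \<alpha> * (1 / real p) ^ m"
        using x(1) y(1) unfolding lipschitz_with_def by (metis (no_types, lifting) diff dist mem_Collect_eq)
      then have "1 / real p * (1 / real p) ^ m \<le> \<alpha> * (1 / real p) ^ m" by (simp only: power_Suc)
      then show "1 / real p \<le> \<alpha>" by (rule mult_right_le_imp_le) (use p0 in simp)
    qed
    then show ?thesis using ne by simp
  qed
  then show "f \<in> scaled_van_der_put p"
    unfolding scaled_van_der_put_def using e c scaled by blast
qed

end
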